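(* The Pfaffian differential system $(\mathfrak I_3,\alpha^1\wedge\alpha^2)$ on the configuration space $\mathcal D$ (the system, defined in the context, of which isothermic surfaces together with their T-transforms are integral manifolds) is in involution, and its general solution depends on six arbitrary functions in one variable.
   Context: **Group and Maurer--Cartan form.** $\mathbb{R}^{4,2}$ is $\mathbb{R}^6$ (standard basis $e_0,\dots,e_5$) with $\langle x,y\rangle=-(x^0y^5+x^5y^0)+x^1y^1+x^2y^2+x^3y^3-x^4y^4=g_{IJ}x^Iy^J$. $G$ is the identity component of $\mathrm{O}(4,2)$; for $A\in G$ put $A_J=Ae_J$. The Maurer--Cartan form $\omega=A^{-1}dA=(\omega^I_J)$, $dA_J=\omega^I_JA_I$, satisfies $d\omega^I_J=-\omega^I_K\wedge\omega^K_J$ and $\omega^K_Ig_{KJ}+\omega^K_Jg_{KI}=0$. On $G\times G$ the Maurer--Cartan form is denoted $(\omega,\Omega)$. **Configuration space.** $\mathcal{P}$ is the 8-dimensional homogeneous space of 3-planes $V\subset\mathbb{R}^{4,2}$ with $\dim V\cap V^\perp=1$ and $\langle\cdot,\cdot\rangle$ positive definite on $V/(V\cap V^\perp)$, with base point $[e_0\wedge e_1\wedge e_2]$. The isotropy subgroup of the base point consists of the elements of $G$ of block form $$\begin{pmatrix} r&x^Ta&y^T\mathbb{I}_{1,1}b&\frac{1}{2r}(x^Tx+y^T\mathbb{I}_{1,1}y)\\0&a&0&x/r\\0&0&b&y/r\\0&0&0&1/r\end{pmatrix},$$ $a\in\mathrm{SO}(2)$, $b\in\mathrm{SO}(1,1)$,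 $x,y\in\mathbb{R}^2$, $r>0$, $\mathbb{I}_{1,1}=\mathrm{diag}(1,-1)$. $\mathcal{D}=\{(V_1,V_2,F)\in\mathcal{P}\times\mathcal{P}\times G:F\cdot V_1=V_2\}$ is a 23-dimensional homogeneous space of $G\times G$ with projection $\pi_{\mathcal D}:G\times G\to\mathcal D$, $(A,B)\mapsto([A_0\wedge A_1\wedge A_2],[B_0\wedge B_1\wedge B_2],BA^{-1})$. **The system.** Let $(\alpha,\beta)$ be the pullback of $(\omega,\Omega)$ by a local section of $\pi_{\mathcal D}$; put $\alpha^1=\alpha^1_0$, $\alpha^2=\alpha^2_0$. $\mathfrak I_3$ is the ideal differentially generated by $$I_3=\mathrm{span}\{\alpha^i_0-\beta^i_0,\ \alpha^a_0,\ \beta^a_0,\ \alpha^0_0-\beta^0_0,\ \alpha^2_1-\beta^2_1,\ \alpha^a_i-\beta^a_i,\ \alpha^4_3-\beta^4_3,\ \alpha^0_a-\beta^0_a\},\quad i=1,2;\ a=3,4,$$ (independent of the local section), with independence condition $\alpha^1\wedge\alpha^2\ne0$. Its integral manifolds are 2-dimensional. **Terminology.** Involution and Cartan characters are in the standard sense of Cartan--Kähler theory; an integral manifold is a general solution if all its tangent integral elements are ordinary. "Depends on six arbitrary functions in one variable" means that the last nonzero Cartan character is $s_1=6$ (and $s_2=0$). *)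

theory Defs
  imports "HOL-Analysis.Analysis" "HOL-Combinatorics.Permutations"
begin

section \<open>Smooth maps\<close>

primrec Ck_on :: "nat \<Rightarrow> 'a::real_normed_vector set \<Rightarrow> ('a \<Rightarrow> 'b::real_normed_vector) \<Rightarrow> bool" where
  "Ck_on 0 W f \<longleftrightarrow> continuous_on W f"
| "Ck_on (Suc k) W f \<longleftrightarrow> (\<forall>x\<in>W. f differentiable (at x)) \<and>
     (\<forall>v. Ck_on k W (\<lambda>x. frechet_derivative f (at x) v))"

definition smooth_on :: "'a::real_normed_vector set \<Rightarrow> ('a \<Rightarrow> 'b::real_normed_vector) \<Rightarrow> bool" where
  "smooth_on W f \<longleftrightarrow> (\<forall>k. Ck_on k W f)"

text \<open>For \<open>S\<close> an embedded submanifold this is smoothness of \<open>f\<close> as a map on that submanifold.\<close>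

definition smooth_on_subset :: "'a::real_normed_vector set \<Rightarrow> ('a \<Rightarrow> 'b::real_normed_vector) \<Rightarrow> bool" where
  "smooth_on_subset S f \<longleftrightarrow>
     (\<forall>p\<in>S. \<exists>N g. open N \<and> p \<in> N \<and> smooth_on N g \<and> (\<forall>q\<in>N \<inter> S. g q = f q))"


section \<open>Differential forms on an open subset of a Euclidean space\<close>

text \<open>A \<open>k\<close>-form at a point is a function of the first \<open>k\<close> entries of a sequence of vectors.\<close>

type_synonym 'a dform = "'a \<Rightarrow> (nat \<Rightarrow> 'a) \<Rightarrow> real"

definition alternating_form :: "nat \<Rightarrow> ((nat \<Rightarrow> 'a::euclidean_space) \<Rightarrow> real) \<Rightarrow> bool" where
  "alternating_form k f \<longleftrightarrow>
     (\<forall>v v'. (\<forall>i<k. v i = v' i) \<longrightarrow> f v = f v') \<and>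
     (\<forall>v. \<forall>i<k. linear (\<lambda>u. f (v(i := u)))) \<and>
     (\<forall>v. \<forall>i<k. \<forall>j<k. i \<noteq> j \<and> v i = v j \<longrightarrow> f v = 0)"

definition smooth_form :: "'a::euclidean_space set \<Rightarrow> nat \<Rightarrow> 'a dform \<Rightarrow> bool" where
  "smooth_form W k \<phi> \<longleftrightarrow>
     (\<forall>x\<in>W. alternating_form k (\<phi> x)) \<and> (\<forall>v. smooth_on W (\<lambda>x. \<phi> x v))"

definition wedge :: "nat \<Rightarrow> nat \<Rightarrow> 'a dform \<Rightarrow> 'a dform \<Rightarrow> 'a dform" where
  "wedge k l \<phi> \<psi> = (\<lambda>x v.
     (\<Sum>\<pi> | \<pi> permutes {..<k + l}.
        of_int (sign \<pi>) * \<phi> x (\<lambda>i. v (\<pi> i)) * \<psi> x (\<lambda>i. v (\<pi> (k + i)))) / (fact k * fact l))"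

definition ext_deriv :: "nat \<Rightarrow> 'a::euclidean_space dform \<Rightarrow> 'a dform" where
  "ext_deriv k \<phi> = (\<lambda>x v.
     \<Sum>i\<le>k. (- 1) ^ i *
       frechet_derivative (\<lambda>y. \<phi> y (\<lambda>j. if j < i then v j else v (Suc j))) (at x) (v i))"

text \<open>The smallest ideal of smooth forms on \<open>W\<close> that contains the \<open>1\<close>-forms \<open>\<Theta>\<close> and is closed
  under \<open>d\<close>; \<open>diff_ideal W \<Theta> k\<close> is its part of degree \<open>k\<close>. Left multiples suffice by graded
  commutativity.\<close>

inductive diff_ideal :: "'a::euclidean_space set \<Rightarrow> 'a dform set \<Rightarrow> nat \<Rightarrow> 'a dform \<Rightarrow> bool"
  for W :: "'a set" and \<Theta> :: "'a dform set" where
  gen: "\<theta> \<in> \<Theta> \<Longrightarrow> diff_ideal W \<Theta> 1 \<theta>"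
| zero: "diff_ideal W \<Theta> k (\<lambda>x v. 0)"
| add: "diff_ideal W \<Theta> k \<phi> \<Longrightarrow> diff_ideal W \<Theta> k \<psi> \<Longrightarrow> diff_ideal W \<Theta> k (\<lambda>x v. \<phi> x v + \<psi> x v)"
| mult: "smooth_form W l \<eta> \<Longrightarrow> diff_ideal W \<Theta> k \<phi> \<Longrightarrow> diff_ideal W \<Theta> (l + k) (wedge l k \<eta> \<phi>)"
| deriv: "diff_ideal W \<Theta> k \<phi> \<Longrightarrow> diff_ideal W \<Theta> (Suc k) (ext_deriv k \<phi>)"


section \<open>Integral elements, involution and Cartan characters\<close>

text \<open>In this section \<open>I k \<phi>\<close> says that the \<open>k\<close>-form \<open>\<phi>\<close> belongs to a differential ideal on the
  open set \<open>W\<close>. Forms of degree greater than \<open>n\<close> vanish on every \<open>n\<close>-dimensional subspace.\<close>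

definition integral_element ::
    "(nat \<Rightarrow> 'a::euclidean_space dform \<Rightarrow> bool) \<Rightarrow> nat \<Rightarrow> 'a \<Rightarrow> 'a set \<Rightarrow> bool" where
  "integral_element I n x E \<longleftrightarrow> subspace E \<and> dim E = n \<and>
     (\<forall>k\<le>n. \<forall>\<phi>. I k \<phi> \<longrightarrow> (\<forall>e. (\<forall>i. e i \<in> E) \<longrightarrow> \<phi> x e = 0))"

text \<open>The polar space \<open>H(E)\<close>, its codimension, and \<open>r(E) = dim H(E) - (n + 1)\<close>.\<close>

definition polar_space ::
    "(nat \<Rightarrow> 'a::euclidean_space dform \<Rightarrow> bool) \<Rightarrow> nat \<Rightarrow> 'a \<Rightarrow> 'a set \<Rightarrow> 'a set" where
  "polar_space I n x E =
     {v. \<forall>\<phi>. I (Suc n) \<phi> \<longrightarrow> (\<forall>e. (\<forall>i. e i \<in> E) \<longrightarrow> \<phi> x (case_nat v e) = 0)}"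

definition polar_codim ::
    "(nat \<Rightarrow> 'a::euclidean_space dform \<Rightarrow> bool) \<Rightarrow> nat \<Rightarrow> 'a \<Rightarrow> 'a set \<Rightarrow> int" where
  "polar_codim I n x E = int DIM('a) - int (dim (polar_space I n x E))"

definition ext_rank ::
    "(nat \<Rightarrow> 'a::euclidean_space dform \<Rightarrow> bool) \<Rightarrow> nat \<Rightarrow> 'a \<Rightarrow> 'a set \<Rightarrow> int" where
  "ext_rank I n x E = int (dim (polar_space I n x E)) - int (n + 1)"

text \<open>The Grassmann bundle of tangent \<open>n\<close>-planes is handled through its frame bundle: a plane is
  given by a frame (the first \<open>n\<close> entries of a sequence), and the planes spanned by the frames
  \<open>\<epsilon>\<close>-close to a given one form a neighbourhood basis.\<close>

definition frame_of :: "nat \<Rightarrow> (nat \<Rightarrow> 'a::euclidean_space) \<Rightarrow> 'a set \<Rightarrow> bool" where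
  "frame_of n e E \<longleftrightarrow> span (e ` {..<n}) = E \<and> dim E = n"

definition frame_close ::
    "nat \<Rightarrow> real \<Rightarrow> 'a::euclidean_space \<Rightarrow> (nat \<Rightarrow> 'a) \<Rightarrow> 'a \<Rightarrow> (nat \<Rightarrow> 'a) \<Rightarrow> bool" where
  "frame_close n \<epsilon> x e x' e' \<longleftrightarrow> dist x x' < \<epsilon> \<and> (\<forall>i<n. dist (e i) (e' i) < \<epsilon>)"

text \<open>The function \<open>\<phi>\<^sub>\<Omega>\<close> on \<open>{E. \<Omega>\<^sub>E \<noteq> 0}\<close> determined by \<open>\<phi>\<^sub>E = \<phi>\<^sub>\<Omega>(E) \<Omega>\<^sub>E\<close>, pulled back to frames.\<close>

definition form_ratio :: "'a dform \<Rightarrow> 'a dform \<Rightarrow> 'a \<Rightarrow> (nat \<Rightarrow> 'a) \<Rightarrow> real" where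
  "form_ratio \<Omega> \<phi> x e = \<phi> x e / \<Omega> x e"

definition differentials_independent ::
    "('a::euclidean_space \<Rightarrow> (nat \<Rightarrow> 'a) \<Rightarrow> real) list \<Rightarrow> 'a \<Rightarrow> (nat \<Rightarrow> 'a) \<Rightarrow> bool" where
  "differentials_independent fs x e \<longleftrightarrow>
     (\<forall>c :: nat \<Rightarrow> real.
        (\<forall>x' e'. (\<Sum>j<length fs. c j *
            deriv (\<lambda>t::real. (fs ! j) (x + t *\<^sub>R x') (\<lambda>i. e i + t *\<^sub>R e' i)) 0) = 0) \<longrightarrow>
        (\<forall>j<length fs. c j = 0))"

text \<open>\<open>E\<close> is Kaehler-ordinary: for some \<open>n\<close>-form \<open>\<Omega>\<close> with \<open>\<Omega>\<^sub>E \<noteq> 0\<close>, \<open>E\<close> is an ordinary zero of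
  the functions \<open>\<phi>\<^sub>\<Omega>\<close>, \<open>\<phi> \<in> I\<close> of degree \<open>n\<close>, i.e. near \<open>E\<close> their common zero set is cut out by
  finitely many of them with independent differentials. For \<open>n = 0\<close> this says that \<open>x\<close> is an
  ordinary zero of the functions contained in the ideal.\<close>

definition kaehler_ordinary ::
    "'a::euclidean_space set \<Rightarrow> (nat \<Rightarrow> 'a dform \<Rightarrow> bool) \<Rightarrow> nat \<Rightarrow> 'a \<Rightarrow> 'a set \<Rightarrow> bool" where
  "kaehler_ordinary W I n x E \<longleftrightarrow> x \<in> W \<and> integral_element I n x E \<and>
     (\<exists>\<Omega> e \<phi>s \<epsilon>. smooth_form W n \<Omega> \<and> frame_of n e E \<and> \<Omega> x e \<noteq> 0 \<and>
        (\<forall>\<phi>\<in>set \<phi>s. I n \<phi>) \<and> \<epsilon> > 0 \<and>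
        (\<forall>x' e'. frame_close n \<epsilon> x e x' e' \<longrightarrow>
           x' \<in> W \<and> \<Omega> x' e' \<noteq> 0 \<and>
           differentials_independent (map (form_ratio \<Omega>) \<phi>s) x' e' \<and>
           ((\<forall>\<phi>. I n \<phi> \<longrightarrow> form_ratio \<Omega> \<phi> x' e' = 0) \<longleftrightarrow>
            (\<forall>\<phi>\<in>set \<phi>s. form_ratio \<Omega> \<phi> x' e' = 0))))"

definition kaehler_regular ::
    "'a::euclidean_space set \<Rightarrow> (nat \<Rightarrow> 'a dform \<Rightarrow> bool) \<Rightarrow> nat \<Rightarrow> 'a \<Rightarrow> 'a set \<Rightarrow> bool" where
  "kaehler_regular W I n x E \<longleftrightarrow> kaehler_ordinary W I n x E \<and>
     (\<exists>e \<epsilon>. frame_of n e E \<and> \<epsilon> > 0 \<and>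
        (\<forall>x' e'. frame_close n \<epsilon> x e x' e' \<and> x' \<in> W \<and>
             integral_element I n x' (span (e' ` {..<n})) \<longrightarrow>
           ext_rank I n x' (span (e' ` {..<n})) = ext_rank I n x E))"

definition ordinary_flag ::
    "'a::euclidean_space set \<Rightarrow> (nat \<Rightarrow> 'a dform \<Rightarrow> bool) \<Rightarrow> nat \<Rightarrow> 'a \<Rightarrow> (nat \<Rightarrow> 'a set) \<Rightarrow> bool" where
  "ordinary_flag W I n x F \<longleftrightarrow>
     (\<forall>k\<le>n. integral_element I k x (F k)) \<and> (\<forall>k<n. F k \<subseteq> F (Suc k)) \<and>
     kaehler_ordinary W I 0 x {0} \<and> (\<forall>k. 1 \<le> k \<and> k < n \<longrightarrow> kaehler_regular W I k x (F k))"

definition ordinary_element ::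
    "'a::euclidean_space set \<Rightarrow> (nat \<Rightarrow> 'a dform \<Rightarrow> bool) \<Rightarrow> nat \<Rightarrow> 'a \<Rightarrow> 'a set \<Rightarrow> bool" where
  "ordinary_element W I n x E \<longleftrightarrow> (\<exists>F. ordinary_flag W I n x F \<and> F n = E)"

definition nonzero_on :: "'a dform \<Rightarrow> 'a \<Rightarrow> 'a set \<Rightarrow> bool" where
  "nonzero_on \<Omega> x E \<longleftrightarrow> (\<exists>e. (\<forall>i. e i \<in> E) \<and> \<Omega> x e \<noteq> 0)"

definition in_involution_at ::
    "'a::euclidean_space set \<Rightarrow> (nat \<Rightarrow> 'a dform \<Rightarrow> bool) \<Rightarrow> nat \<Rightarrow> 'a dform \<Rightarrow> 'a \<Rightarrow> bool" where
  "in_involution_at W I n \<Omega> x \<longleftrightarrow> (\<exists>E. ordinary_element W I n x E \<and> nonzero_on \<Omega> x E)"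

definition cartan_character ::
    "(nat \<Rightarrow> 'a::euclidean_space dform \<Rightarrow> bool) \<Rightarrow> nat \<Rightarrow> 'a \<Rightarrow> (nat \<Rightarrow> 'a set) \<Rightarrow> nat \<Rightarrow> int" where
  "cartan_character I n x F k =
     (if k = 0 then polar_codim I 0 x (F 0)
      else if k < n then polar_codim I k x (F k) - polar_codim I (k - 1) x (F (k - 1))
      else int DIM('a) - int n - polar_codim I (n - 1) x (F (n - 1)))"

text \<open>The tangent integral elements of a general solution are ordinary by definition, so its
  characters are those of the ordinary integral elements satisfying the independence condition;
  \<open>s\<^sub>q = m\<close> is required to be the last nonzero one.\<close>

definition general_solution_depends_on_at ::
    "'a::euclidean_space set \<Rightarrow> (nat \<Rightarrow> 'a dform \<Rightarrow> bool) \<Rightarrow> nat \<Rightarrow> 'a dform \<Rightarrow> nat \<Rightarrow> nat \<Rightarrow> 'a \<Rightarrow> bool" where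
  "general_solution_depends_on_at W I n \<Omega> m q x \<longleftrightarrow>
     (\<forall>F. ordinary_flag W I n x F \<and> nonzero_on \<Omega> x (F n) \<longrightarrow>
        cartan_character I n x F q = int m \<and>
        (\<forall>k. q < k \<and> k \<le> n \<longrightarrow> cartan_character I n x F k = 0))"


section \<open>The group and the configuration space\<close>

text \<open>The indices \<open>0, \<dots>, 5\<close> are the elements of the type \<open>6\<close>.\<close>

definition ip42 :: "real^6 \<Rightarrow> real^6 \<Rightarrow> real" where
  "ip42 x y = - (x$0 * y$5 + x$5 * y$0) + x$1 * y$1 + x$2 * y$2 + x$3 * y$3 - x$4 * y$4"

definition O42 :: "(real^6^6) set" where
  "O42 = {A. \<forall>x y. ip42 (A *v x) (A *v y) = ip42 x y}"

definition G42 :: "(real^6^6) set" where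
  "G42 = connected_component_set O42 (mat 1)"

definition perp42 :: "(real^6) set \<Rightarrow> (real^6) set" where
  "perp42 V = {x. \<forall>y\<in>V. ip42 x y = 0}"

text \<open>Positive definiteness on the quotient of \<open>V\<close> by its radical is stated on representatives.\<close>

definition P_space :: "(real^6) set set" where
  "P_space = {V. subspace V \<and> dim V = 3 \<and> dim (V \<inter> perp42 V) = 1 \<and>
     (\<forall>v\<in>V - perp42 V. ip42 v v > 0)}"

type_synonym config = "(real^6) set \<times> (real^6) set \<times> (real^6^6)"

definition D_space :: "config set" where
  "D_space = {(V1, V2, F). V1 \<in> P_space \<and> V2 \<in> P_space \<and> F \<in> G42 \<and> (\<lambda>v. F *v v) ` V1 = V2}"

definition proj_D :: "(real^6^6) \<times> (real^6^6) \<Rightarrow> config" where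
  "proj_D = (\<lambda>(A, B). (span {column 0 A, column 1 A, column 2 A},
                       span {column 0 B, column 1 B, column 2 B},
                       B ** matrix_inv A))"

text \<open>\<open>x\<close> is a coordinate chart with domain \<open>U\<close> for the quotient manifold structure of the
  homogeneous space, and \<open>s\<close> is a smooth section of the projection over \<open>U\<close>. The existence of \<open>s\<close>
  accounts for the smoothness of the inverse of \<open>x\<close>.\<close>

definition chart_with_section ::
    "config set \<Rightarrow> (config \<Rightarrow> real^23) \<Rightarrow> (config \<Rightarrow> (real^6^6) \<times> (real^6^6)) \<Rightarrow> bool" where
  "chart_with_section U x s \<longleftrightarrow>
     U \<subseteq> D_space \<and>
     openin (top_of_set (G42 \<times> G42)) {g \<in> G42 \<times> G42. proj_D g \<in> U} \<and>
     inj_on x U \<and> open (x ` U) \<and>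
     smooth_on_subset {g \<in> G42 \<times> G42. proj_D g \<in> U} (\<lambda>g. x (proj_D g)) \<and>
     (\<forall>p\<in>U. s p \<in> G42 \<times> G42 \<and> proj_D (s p) = p) \<and>
     smooth_on (x ` U) (\<lambda>w. s (inv_into U x w))"


section \<open>The differential system\<close>

text \<open>The \<open>(J, K)\<close> entry (row \<open>J\<close>, column \<open>K\<close>) of the pullback of \<open>A\<^sup>-\<^sup>1 dA\<close> by a matrix-valued map.\<close>

definition mc_form :: "('a::euclidean_space \<Rightarrow> real^6^6) \<Rightarrow> 6 \<Rightarrow> 6 \<Rightarrow> 'a dform" where
  "mc_form A J K =
     (\<lambda>w v. (matrix_inv (A w) ** frechet_derivative A (at w) (v 0)) $ J $ K)"

definition I3_gens :: "(6 \<Rightarrow> 6 \<Rightarrow> 'a dform) \<Rightarrow> (6 \<Rightarrow> 6 \<Rightarrow> 'a dform) \<Rightarrow> 'a dform set" where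
  "I3_gens \<alpha> \<beta> =
     {\<alpha> i 0 - \<beta> i 0 | i. i \<in> {1, 2}} \<union>
     {\<alpha> a 0 | a. a \<in> {3, 4}} \<union>
     {\<beta> a 0 | a. a \<in> {3, 4}} \<union>
     {\<alpha> 0 0 - \<beta> 0 0, \<alpha> 2 1 - \<beta> 2 1, \<alpha> 4 3 - \<beta> 4 3} \<union>
     {\<alpha> a i - \<beta> a i | a i. a \<in> {3, 4} \<and> i \<in> {1, 2}} \<union>
     {\<alpha> 0 a - \<beta> 0 a | a. a \<in> {3, 4}}"

definition alpha_form ::
    "config set \<Rightarrow> (config \<Rightarrow> real^23) \<Rightarrow> (config \<Rightarrow> (real^6^6) \<times> (real^6^6)) \<Rightarrow> 6 \<Rightarrow> 6 \<Rightarrow> (real^23) dform" where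
  "alpha_form U x s = mc_form (\<lambda>w. fst (s (inv_into U x w)))"

definition beta_form ::
    "config set \<Rightarrow> (config \<Rightarrow> real^23) \<Rightarrow> (config \<Rightarrow> (real^6^6) \<times> (real^6^6)) \<Rightarrow> 6 \<Rightarrow> 6 \<Rightarrow> (real^23) dform" where
  "beta_form U x s = mc_form (\<lambda>w. snd (s (inv_into U x w)))"

definition I3_ideal ::
    "config set \<Rightarrow> (config \<Rightarrow> real^23) \<Rightarrow> (config \<Rightarrow> (real^6^6) \<times> (real^6^6)) \<Rightarrow> nat \<Rightarrow> (real^23) dform \<Rightarrow> bool" where
  "I3_ideal U x s = diff_ideal (x ` U) (I3_gens (alpha_form U x s) (beta_form U x s))"

definition independence_form ::
    "config set \<Rightarrow> (config \<Rightarrow> real^23) \<Rightarrow> (config \<Rightarrow> (real^6^6) \<times> (real^6^6)) \<Rightarrow> (real^23) dform" where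
  "independence_form U x s = wedge 1 1 (alpha_form U x s 1 0) (alpha_form U x s 2 0)"

end

(* Near a point the generators, together with alpha^i_0, alpha^a_i and alpha^0_i - beta^0_i, form a
   coframe of the 23-dimensional configuration space: a vector killed by all of them moves the section
   along the fibre of the projection, to first order, while the projection of the section is the
   identity. Modulo the 15 generators the Maurer-Cartan equations leave six 2-forms in the remaining 8
   covectors. At a vector v of the kernel where (alpha^i_0) and (alpha^0_i - beta^0_i) are linearly
   independent, the six polar equations are independent, and such v are dense in the kernel. Hence on
   every ordinary flag the polar codimensions are 15 and 21, so s_1 = 6 and s_2 = 0; and the polar
   space of such a v is itself an integral element, which proves involution. *)

theory Submission
  imports Defs
begin

section \<open>Low-degree part of the ideal\<close>

text \<open>Integral elements, polar spaces and ordinariness quantify over every form of an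
  inductively generated ideal, so the obstacle is to bound that ideal from above. Degrees 0, 1 and 2
  suffice: integral elements have dimension at most two, and the polar space of a line is tested by
  forms of degree 2. The Cartan computation is separated from the geometry: it uses only 23
  one-forms whose last 15 members have exterior derivatives governed, on their common kernel, by six
  bilinear relations. The determinant of \<alpha>^i_0 against \<alpha>^0_i - \<beta>^0_i enters
  because it decides whether these relations can be solved once \<alpha>^1_0 and \<alpha>^2_0 are
  prescribed. On the geometric side 23 = 15 + 15 - 7: the fibre directions form a diagonal copy of
  the 7-dimensional isotropy algebra, spanned by the velocities of a scaling, a rotation, a boost
  and four translations, which are therefore written out as explicit curves. The Maurer-Cartan
  equations rest on the symmetry of second derivatives and on the inverse in O(4,2) being linear in
  the matrix entries.\<close>

lemma functionals_surjective:
  fixes c :: "nat \<Rightarrow> 'a::euclidean_space \<Rightarrow> real"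
  assumes lin: "\<And>j. j < DIM('a) \<Longrightarrow> linear (c j)"
    and inj: "\<And>u. (\<forall>j<DIM('a). c j u = 0) \<Longrightarrow> u = 0"
  shows "\<exists>u. \<forall>j<DIM('a). c j u = f j"
proof -
  obtain h where h: "bij_betw h {..<DIM('a)} (Basis::'a set)"
    using ex_bij_betw_nat_finite[OF finite_Basis] by (auto simp: atLeast0LessThan)
  define S where "S g = (\<Sum>j<DIM('a). g j *\<^sub>R h j)" for g :: "nat \<Rightarrow> real"
  have S: "inner (S g) (h i) = g i" if "i < DIM('a)" for g i
  proof -
    have "inner (h j) (h i) = (if j = i then 1 else 0)" if "j < DIM('a)" for j
    proof -
      have "h i \<in> Basis" "h j \<in> Basis" "h j = h i \<longleftrightarrow> j = i"
        using h that \<open>i < DIM('a)\<close> by (auto simp: bij_betw_def inj_on_eq_iff)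
      then show ?thesis by (simp add: inner_Basis)
    qed
    then have "inner (S g) (h i) = (\<Sum>j<DIM('a). g j * (if j = i then 1 else 0))"
      by (simp add: S_def inner_sum_left)
    then show ?thesis using that by (simp add: sum.delta if_distrib cong: if_cong)
  qed
  \<comment> \<open>The functionals become the coordinates of an endomorphism, for which injectivity
    implies surjectivity.\<close>
  define T where "T u = S (\<lambda>j. c j u)" for u
  have "linear T"
    unfolding T_def S_def
    by (rule linearI)
      (auto simp: linear_add[OF lin] linear_scale[OF lin] scaleR_add_left sum.distrib scaleR_sum_right)
  moreover have "inj T"
    unfolding linear_injective_0[OF \<open>linear T\<close>]
  proof (intro allI impI)
    fix u assume "T u = 0"
    then have "\<forall>j<DIM('a). c j u = 0" using S[of _ "\<lambda>j. c j u"] by (simp add: T_def)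
    then show "u = 0" by (rule inj)
  qed
  ultimately have "surj T" by (rule linear_injective_imp_surjective) simp_all
  then obtain u where "T u = S f" by (metis surjD)
  then show ?thesis using S by (metis T_def)
qed

lemma dim_eq_functionals:
  fixes c :: "nat \<Rightarrow> 'a::euclidean_space \<Rightarrow> real"
  assumes S: "subspace S" and lin: "\<And>j. j < n \<Longrightarrow> linear (c j)"
    and inj: "\<And>u. u \<in> S \<Longrightarrow> (\<forall>j<n. c j u = 0) \<Longrightarrow> u = 0"
    and dual: "\<And>i. i < n \<Longrightarrow> \<exists>u\<in>S. \<forall>j<n. c j u = (if j = i then 1 else 0)"
  shows "dim S = n"
proof -
  obtain b where b: "\<And>i. i < n \<Longrightarrow> b i \<in> S" "\<And>i j. i < n \<Longrightarrow> j < n \<Longrightarrow> c j (b i) = (if j = i then 1 else 0)"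
    using dual by metis
  have inj_b: "inj_on b {..<n}"
    by (rule inj_onI) (metis b(2) lessThan_iff zero_neq_one)
  have comb: "c j (\<Sum>i<n. a i *\<^sub>R b i) = a j" if "j < n" for a j
  proof -
    have "c j (\<Sum>i<n. a i *\<^sub>R b i) = (\<Sum>i<n. a i * (if j = i then 1 else 0))"
      using that by (simp add: linear_sum[OF lin] linear_scale[OF lin] b)
    then show ?thesis using that by (simp add: sum.delta if_distrib cong: if_cong)
  qed
  have "S \<subseteq> span (b ` {..<n})"
  proof
    fix u assume "u \<in> S"
    define w where "w = (\<Sum>i<n. c i u *\<^sub>R b i)"
    have "w \<in> S" unfolding w_def by (intro subspace_sum[OF S] subspace_scale[OF S] b) auto
    then have "u - w \<in> S" using \<open>u \<in> S\<close> by (intro subspace_diff[OF S])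
    moreover have "\<forall>j<n. c j (u - w) = 0"
      unfolding w_def by (simp add: linear_diff[OF lin] comb)
    ultimately have "u = w" using inj[of "u - w"] by simp
    moreover have "w \<in> span (b ` {..<n})"
      unfolding w_def by (intro span_sum span_scale span_base) simp
    ultimately show "u \<in> span (b ` {..<n})" by simp
  qed
  moreover have "independent (b ` {..<n})"
  proof
    assume "dependent (b ` {..<n})"
    then obtain a where a: "\<exists>v\<in>b ` {..<n}. a v \<noteq> 0" "(\<Sum>v\<in>b ` {..<n}. a v *\<^sub>R v) = 0"
      by (auto simp: dependent_finite)
    from a(2) have "(\<Sum>i<n. a (b i) *\<^sub>R b i) = 0" by (simp add: sum.reindex[OF inj_b])
    then have "a (b j) = 0" if "j < n" for j
      using comb[OF that, of "\<lambda>i. a (b i)"] linear_0[OF lin[OF that]] by simp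
    then show False using a(1) by auto
  qed
  moreover have "b ` {..<n} \<subseteq> S" using b by auto
  ultimately show ?thesis
    by (intro dim_unique) (auto simp: card_image[OF inj_b])
qed

section \<open>Forms of degree at most two as functions of sequences\<close>

lemma smooth_on_differentiable:
  assumes "smooth_on W f" "x \<in> W"
  shows "f differentiable (at x)"
proof -
  have "Ck_on (Suc 0) W f" using assms(1) by (simp only: smooth_on_def)
  then show ?thesis using assms(2) by simp
qed

lemma smooth_on_continuous: "smooth_on W f \<Longrightarrow> continuous_on W f"
  unfolding smooth_on_def by (drule spec[of _ 0]) simp

lemma permutes_lessThan_1: "{\<pi>. \<pi> permutes {..<Suc 0}} = {id}"
  by (simp add: lessThan_Suc permutes_sing Collect_conv_if)

lemma transpose_0_1_neq_id: "id \<noteq> Transposition.transpose 0 (Suc 0)"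
  by (metis id_apply transpose_apply_first nat.distinct(1))

lemma permutes_lessThan_2: "{\<pi>. \<pi> permutes {..<2}} = {id, Transposition.transpose 0 (Suc 0)}"
proof (rule card_subset_eq[symmetric])
  show "finite {\<pi>. \<pi> permutes {..<2::nat}}" by (simp add: finite_permutations)
  have "Transposition.transpose 0 (Suc 0) permutes {..<2}" by (rule permutes_swap_id) simp_all
  then show "{id, Transposition.transpose 0 (Suc 0)} \<subseteq> {\<pi>. \<pi> permutes {..<2}}"
    using permutes_id by simp
  show "card {id, Transposition.transpose 0 (Suc 0)} = card {\<pi>. \<pi> permutes {..<2::nat}}"
    using transpose_0_1_neq_id card_permutations[of "{..<2::nat}" 2] by simp
qed

lemma wedge_1_1:
  "wedge 1 1 \<phi> \<psi> x v =
     \<phi> x v * \<psi> x (\<lambda>i. v (Suc i)) - \<phi> x (\<lambda>i. v (Transposition.transpose 0 1 i)) * \<psi> x (\<lambda>i. v (Transposition.transpose 0 1 (Suc i)))"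
  by (simp add: wedge_def numeral_2_eq_2[symmetric] permutes_lessThan_2 transpose_0_1_neq_id sign_swap_id sign_id)

lemma wedge_0_1: "wedge 0 1 \<phi> \<psi> x v = \<phi> x v * \<psi> x v"
  by (simp add: wedge_def permutes_lessThan_1 sign_id)

text \<open>The definition sums over all permutations, so the value is a signed average and not a
  plain product. For this reason the degree 2 clause in the description of the ideal has to survive
  swapping the two vectors.\<close>

lemma wedge_0_2:
  "wedge 0 2 \<phi> \<psi> x v =
     (\<phi> x v * \<psi> x v - \<phi> x (\<lambda>i. v (Transposition.transpose 0 1 i)) * \<psi> x (\<lambda>i. v (Transposition.transpose 0 1 i))) / 2"
  by (simp add: wedge_def numeral_2_eq_2[symmetric] permutes_lessThan_2 transpose_0_1_neq_id sign_swap_id sign_id)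

lemma ext_deriv_1:
  "ext_deriv 1 \<phi> x v =
     frechet_derivative (\<lambda>y. \<phi> y (\<lambda>j. v (Suc j))) (at x) (v 0)
     - frechet_derivative (\<lambda>y. \<phi> y (\<lambda>j. if j = 0 then v 0 else v (Suc j))) (at x) (v 1)"
  by (simp add: ext_deriv_def cong: if_cong)

lemma alternating_form_1_const: "alternating_form 1 f \<Longrightarrow> f v = f (\<lambda>_. v 0)"
  unfolding alternating_form_def by (elim conjE allE[of _ v] allE[of _ "\<lambda>_. v 0"]) simp

lemma alternating_form_1_linear:
  assumes "alternating_form 1 f"
  shows "linear (\<lambda>u. f (\<lambda>_. u))"
proof -
  have "f ((\<lambda>_. 0)(0 := u)) = f (\<lambda>_. u)" for u
    by (subst alternating_form_1_const[OF assms]) simp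
  moreover have "linear (\<lambda>u. f ((\<lambda>_. 0)(0 := u)))"
    using assms unfolding alternating_form_def by (elim conjE allE[of _ "\<lambda>_. 0"]) simp
  ultimately show ?thesis by simp
qed

lemma alternating_form_1I:
  assumes "linear g" "\<And>v. f v = g (v 0)"
  shows "alternating_form 1 f"
  using assms(1) unfolding alternating_form_def assms(2) by simp

lemma smooth_form_1_const: "smooth_form W 1 \<phi> \<Longrightarrow> x \<in> W \<Longrightarrow> \<phi> x v = \<phi> x (\<lambda>_. v 0)"
  unfolding smooth_form_def by (rule alternating_form_1_const[of "\<phi> x"]) simp

lemma smooth_form_1_linear: "smooth_form W 1 \<phi> \<Longrightarrow> x \<in> W \<Longrightarrow> linear (\<lambda>u. \<phi> x (\<lambda>_. u))"
  unfolding smooth_form_def by (rule alternating_form_1_linear[of "\<phi> x"]) simp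

lemma smooth_form_1_differentiable:
  "smooth_form W 1 \<phi> \<Longrightarrow> x \<in> W \<Longrightarrow> (\<lambda>y. \<phi> y v) differentiable (at x)"
  unfolding smooth_form_def by (rule smooth_on_differentiable) simp_all

lemma frechet_derivative_form_1:
  assumes "open W" "smooth_form W 1 \<phi>" "x \<in> W"
  shows "frechet_derivative (\<lambda>y. \<phi> y e) (at x) = frechet_derivative (\<lambda>y. \<phi> y (\<lambda>_. e 0)) (at x)"
proof (rule frechet_derivative_transform_within_open)
  show "\<phi> y e = \<phi> y (\<lambda>_. e 0)" if "y \<in> W" for y
    using assms(2) that by (rule smooth_form_1_const)
qed (use assms smooth_form_1_differentiable in auto)

lemma ext_deriv_1_const:
  assumes "open W" "smooth_form W 1 \<phi>" "x \<in> W"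
  shows "ext_deriv 1 \<phi> x v =
    frechet_derivative (\<lambda>y. \<phi> y (\<lambda>_. v 1)) (at x) (v 0) - frechet_derivative (\<lambda>y. \<phi> y (\<lambda>_. v 0)) (at x) (v 1)"
proof -
  have "frechet_derivative (\<lambda>y. \<phi> y (\<lambda>j. v (Suc j))) (at x) = frechet_derivative (\<lambda>y. \<phi> y (\<lambda>_. v 1)) (at x)"
    by (subst frechet_derivative_form_1[OF assms]) simp
  moreover have "frechet_derivative (\<lambda>y. \<phi> y (\<lambda>j. if j = 0 then v 0 else v (Suc j))) (at x)
      = frechet_derivative (\<lambda>y. \<phi> y (\<lambda>_. v 0)) (at x)"
    by (subst frechet_derivative_form_1[OF assms]) simp
  ultimately show ?thesis unfolding ext_deriv_1 by simp
qed

lemma ext_deriv_1_swap: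
  assumes "open W" "smooth_form W 1 \<phi>" "x \<in> W"
  shows "ext_deriv 1 \<phi> x (\<lambda>i. v (Transposition.transpose 0 1 i)) = - ext_deriv 1 \<phi> x v"
  unfolding ext_deriv_1_const[OF assms] by simp

text \<open>The three clauses depend on each other in the induction. Since degree 0 contains only
  zero, no differentials of functions enter degree 1; differentiable coefficients in degree 1 make
  the product rule available; in degree 2 a vanishing statement suffices, because d(c \<kappa>) = dc
  \<and> \<kappa> + c d\<kappa> and the first summand vanishes on vectors killed by
  \<kappa>.\<close>

lemma diff_ideal_low_degree:
  fixes \<kappa> :: "nat \<Rightarrow> 'a::euclidean_space dform"
  assumes W: "open W" and J: "finite J" and sm: "\<And>j. j \<in> J \<Longrightarrow> smooth_form W 1 (\<kappa> j)"
    and "diff_ideal W (\<kappa> ` J) k \<phi>"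
  shows "(k = 0 \<longrightarrow> (\<forall>x v. \<phi> x v = 0)) \<and>
    (k = 1 \<longrightarrow> (\<exists>c. (\<forall>j\<in>J. \<forall>x\<in>W. c j differentiable (at x)) \<and>
        (\<forall>x\<in>W. \<forall>v. \<phi> x v = (\<Sum>j\<in>J. c j x * \<kappa> j x v)))) \<and>
    (k = 2 \<longrightarrow> (\<forall>x\<in>W. \<forall>v. (\<forall>j\<in>J. \<forall>i<2. \<kappa> j x (\<lambda>_. v i) = 0) \<and>
        (\<forall>j\<in>J. ext_deriv 1 (\<kappa> j) x v = 0) \<longrightarrow> \<phi> x v = 0))"
  using assms(4)
proof (induction rule: diff_ideal.induct)
  case (gen \<theta>)
  then obtain i where i: "i \<in> J" "\<theta> = \<kappa> i" by auto
  have "\<theta> x v = (\<Sum>j\<in>J. (if j = i then 1 else 0) * \<kappa> j x v)" for x v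
    using i J by (simp add: if_distribR sum.delta if_distrib cong: if_cong)
  then show ?case by (auto intro!: exI[of _ "\<lambda>j x. if j = i then 1 else 0"])
next
  case (zero k)
  show ?case by (auto intro!: exI[of _ "\<lambda>j x. 0"])
next
  case (add k \<phi> \<psi>)
  have "\<exists>c. (\<forall>j\<in>J. \<forall>x\<in>W. c j differentiable (at x)) \<and>
        (\<forall>x\<in>W. \<forall>v. \<phi> x v + \<psi> x v = (\<Sum>j\<in>J. c j x * \<kappa> j x v))" if k: "k = 1"
  proof -
    obtain c where c: "\<forall>j\<in>J. \<forall>x\<in>W. c j differentiable (at x)" "\<forall>x\<in>W. \<forall>v. \<phi> x v = (\<Sum>j\<in>J. c j x * \<kappa> j x v)"
      using add.IH(1)[THEN conjunct2, THEN conjunct1, THEN mp, OF k] by (elim exE conjE)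
    obtain d where d: "\<forall>j\<in>J. \<forall>x\<in>W. d j differentiable (at x)" "\<forall>x\<in>W. \<forall>v. \<psi> x v = (\<Sum>j\<in>J. d j x * \<kappa> j x v)"
      using add.IH(2)[THEN conjunct2, THEN conjunct1, THEN mp, OF k] by (elim exE conjE)
    show ?thesis
      by (rule exI[of _ "\<lambda>j x. c j x + d j x"])
        (use c d in \<open>auto simp: algebra_simps sum.distrib\<close>)
  qed
  moreover have "\<phi> x v + \<psi> x v = 0" if "k = 0" for x v
    using add.IH[THEN conjunct1, THEN mp, OF that] by simp
  moreover have "\<phi> x v + \<psi> x v = 0" if "k = 2" "x \<in> W" "\<forall>j\<in>J. \<forall>i<2. \<kappa> j x (\<lambda>_. v i) = 0"
    "\<forall>j\<in>J. ext_deriv 1 (\<kappa> j) x v = 0" for x v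
    using add.IH[THEN conjunct2, THEN conjunct2, THEN mp, OF that(1), rule_format, OF that(2)] that(3,4) by simp
  ultimately show ?case by simp
next
  case (mult l \<eta> k \<phi>)
  have zero: "wedge l k \<eta> \<phi> x v = 0" if "k = 0" for x v
    using mult.IH[THEN conjunct1, THEN mp, OF that] by (simp add: wedge_def)
  have one: "\<exists>c. (\<forall>j\<in>J. \<forall>x\<in>W. c j differentiable (at x)) \<and>
        (\<forall>x\<in>W. \<forall>v. wedge l k \<eta> \<phi> x v = (\<Sum>j\<in>J. c j x * \<kappa> j x v))" if lk: "l = 0" "k = 1"
  proof -
    obtain c where
      c: "\<forall>j\<in>J. \<forall>x\<in>W. c j differentiable (at x)" "\<forall>x\<in>W. \<forall>v. \<phi> x v = (\<Sum>j\<in>J. c j x * \<kappa> j x v)"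
      using mult.IH[THEN conjunct2, THEN conjunct1, THEN mp, OF lk(2)] by (elim exE conjE)
    \<comment> \<open>A 0-form ignores the vectors, so \<open>\<eta>\<close> is a function of the
      base point and can be absorbed into the coefficients.\<close>
    have \<eta>: "\<eta> x v = \<eta> x (\<lambda>_. 0)" if "x \<in> W" for x v
    proof -
      have "alternating_form 0 (\<eta> x)" using mult(1) lk that by (simp add: smooth_form_def)
      then show ?thesis unfolding alternating_form_def by (elim conjE allE[of _ v] allE[of _ "\<lambda>_. 0"]) simp
    qed
    have \<eta>d: "(\<lambda>x. \<eta> x (\<lambda>_. 0)) differentiable (at x)" if "x \<in> W" for x
      using mult(1) that smooth_on_differentiable[of W "\<lambda>x. \<eta> x (\<lambda>_. 0)" x] by (simp add: smooth_form_def)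
    have "wedge l k \<eta> \<phi> x v = (\<Sum>j\<in>J. (\<eta> x (\<lambda>_. 0) * c j x) * \<kappa> j x v)" if "x \<in> W" for x v
      unfolding lk wedge_0_1 using c(2) that \<eta>[of x v] by (simp add: sum_distrib_left mult.assoc)
    then show ?thesis
      using c(1) \<eta>d by (intro exI[of _ "\<lambda>j x. \<eta> x (\<lambda>_. 0) * c j x"]) auto
  qed
  have two: "wedge l k \<eta> \<phi> x v = 0"
    if lk: "l + k = 2" and x: "x \<in> W" and v: "\<forall>j\<in>J. \<forall>i<2. \<kappa> j x (\<lambda>_. v i) = 0"
      "\<forall>j\<in>J. ext_deriv 1 (\<kappa> j) x v = 0" for x v
  proof -
    consider "l = 2" "k = 0" | "l = 1" "k = 1" | "l = 0" "k = 2" using lk by arith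
    then show ?thesis
    proof cases
      case 1
      then show ?thesis using zero by simp
    next
      case 2
      obtain c where c: "\<forall>x\<in>W. \<forall>v. \<phi> x v = (\<Sum>j\<in>J. c j x * \<kappa> j x v)"
        using mult.IH[THEN conjunct2, THEN conjunct1, THEN mp, OF 2(2)] by (elim exE conjE)
      have "\<kappa> j x (\<lambda>i. v (Suc i)) = 0" "\<kappa> j x (\<lambda>i. v (Transposition.transpose 0 1 (Suc i))) = 0" if "j \<in> J" for j
        using smooth_form_1_const[OF sm[OF that] x, of "\<lambda>i. v (Suc i)"]
          smooth_form_1_const[OF sm[OF that] x, of "\<lambda>i. v (Transposition.transpose 0 1 (Suc i))"] v(1) that
        by simp_all
      then have "\<phi> x (\<lambda>i. v (Suc i)) = 0" "\<phi> x (\<lambda>i. v (Transposition.transpose 0 1 (Suc i))) = 0"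
        using c x by simp_all
      then show ?thesis unfolding 2 wedge_1_1 by simp
    next
      case 3
      have IH2: "\<phi> x v = 0" if "\<forall>j\<in>J. \<forall>i<2. \<kappa> j x (\<lambda>_. v i) = 0" "\<forall>j\<in>J. ext_deriv 1 (\<kappa> j) x v = 0" for v
        using mult.IH[THEN conjunct2, THEN conjunct2, THEN mp, OF 3(2), rule_format, OF x] that by simp
      \<comment> \<open>The swapped pair satisfies the same vanishing conditions, so both terms of
        the averaged product are zero.\<close>
      have "\<forall>j\<in>J. \<forall>i<2. \<kappa> j x (\<lambda>_. v (Transposition.transpose 0 1 i)) = 0"
        using v(1) by (auto simp: Transposition.transpose_def)
      moreover have "\<forall>j\<in>J. ext_deriv 1 (\<kappa> j) x (\<lambda>i. v (Transposition.transpose 0 1 i)) = 0"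
        using v(2) ext_deriv_1_swap[OF W sm x] by simp
      ultimately have "\<phi> x (\<lambda>i. v (Transposition.transpose 0 1 i)) = 0"
        by (rule IH2[of "\<lambda>i. v (Transposition.transpose 0 1 i)"])
      moreover have "\<phi> x v = 0" using v by (rule IH2)
      ultimately show ?thesis unfolding 3 wedge_0_2 by simp
    qed
  qed
  have "\<exists>c. (\<forall>j\<in>J. \<forall>x\<in>W. c j differentiable (at x)) \<and>
        (\<forall>x\<in>W. \<forall>v. wedge l k \<eta> \<phi> x v = (\<Sum>j\<in>J. c j x * \<kappa> j x v))" if "l + k = 1"
  proof (cases "k = 0")
    case True
    then show ?thesis using zero by (intro exI[of _ "\<lambda>j x. 0"]) auto
  next
    case False
    then have "l = 0" "k = 1" using that by arith+
    then show ?thesis by (rule one)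
  qed
  moreover have "wedge l k \<eta> \<phi> x v = 0" if "l + k = 0" for x v using zero that by simp
  ultimately show ?case using two by simp
next
  case (deriv k \<phi>)
  have one: "\<exists>c. (\<forall>j\<in>J. \<forall>x\<in>W. c j differentiable (at x)) \<and>
        (\<forall>x\<in>W. \<forall>v. ext_deriv k \<phi> x v = (\<Sum>j\<in>J. c j x * \<kappa> j x v))" if "Suc k = 1"
  proof -
    have "\<phi> = (\<lambda>x v. 0)" using deriv.IH[THEN conjunct1] that by auto
    then have "ext_deriv k \<phi> x v = 0" for x v by (simp add: ext_deriv_def)
    then show ?thesis by (intro exI[of _ "\<lambda>j x. 0"]) auto
  qed
  have two: "ext_deriv k \<phi> x v = 0"
    if k: "Suc k = 2" and x: "x \<in> W" and v: "\<forall>j\<in>J. \<forall>i<2. \<kappa> j x (\<lambda>_. v i) = 0"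
      "\<forall>j\<in>J. ext_deriv 1 (\<kappa> j) x v = 0" for x v
  proof -
    from k have k1: "k = 1" by simp
    obtain c where cd: "\<forall>j\<in>J. \<forall>x\<in>W. c j differentiable (at x)"
      and c2: "\<forall>x\<in>W. \<forall>v. \<phi> x v = (\<Sum>j\<in>J. c j x * \<kappa> j x v)"
      using deriv.IH[THEN conjunct2, THEN conjunct1, THEN mp, OF k1] by (elim exE conjE)
    have c: "\<And>j x. j \<in> J \<Longrightarrow> x\<in>W \<Longrightarrow> c j differentiable (at x)"
      "\<forall>x\<in>W. \<forall>v. \<phi> x v = (\<Sum>j\<in>J. c j x * \<kappa> j x v)"
      using cd c2 by simp_all
    \<comment> \<open>The derivatives of the coefficients drop out, since every
      \<open>\<kappa> j\<close> vanishes on the argument \<open>e\<close>.\<close>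
    have fd: "frechet_derivative (\<lambda>y. \<phi> y e) (at x) u
        = (\<Sum>j\<in>J. c j x * frechet_derivative (\<lambda>y. \<kappa> j y e) (at x) u)"
      if "\<And>j. j \<in> J \<Longrightarrow> \<kappa> j x e = 0" for e u
    proof -
      have kd: "(\<lambda>y. \<kappa> j y e) differentiable (at x)" if "j \<in> J" for j
        using sm[OF that] x by (rule smooth_form_1_differentiable)
      have "((\<lambda>y. \<Sum>j\<in>J. c j y * \<kappa> j y e) has_derivative
          (\<lambda>u. \<Sum>j\<in>J. c j x * frechet_derivative (\<lambda>y. \<kappa> j y e) (at x) u
            + frechet_derivative (c j) (at x) u * \<kappa> j x e)) (at x)"
        by (intro has_derivative_sum has_derivative_mult)
          (use c(1) kd x in \<open>auto simp: frechet_derivative_works[symmetric]\<close>)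
      then have "((\<lambda>y. \<phi> y e) has_derivative
          (\<lambda>u. \<Sum>j\<in>J. c j x * frechet_derivative (\<lambda>y. \<kappa> j y e) (at x) u
            + frechet_derivative (c j) (at x) u * \<kappa> j x e)) (at x)"
        by (rule has_derivative_transform_within_open[OF _ W x]) (use c(2) in auto)
      from frechet_derivative_at[OF this, symmetric] show ?thesis using that by simp
    qed
    have "\<kappa> j x (\<lambda>i. v (Suc i)) = 0" "\<kappa> j x (\<lambda>j. if j = 0 then v 0 else v (Suc j)) = 0" if "j \<in> J" for j
      using smooth_form_1_const[OF sm[OF that] x, of "\<lambda>i. v (Suc i)"]
        smooth_form_1_const[OF sm[OF that] x, of "\<lambda>j. if j = 0 then v 0 else v (Suc j)"] v(1) that
      by simp_all
    then have "ext_deriv 1 \<phi> x v = (\<Sum>j\<in>J. c j x * ext_deriv 1 (\<kappa> j) x v)"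
      unfolding ext_deriv_1 by (simp add: fd sum_subtractf right_diff_distrib)
    then show ?thesis using v(2) k1 by simp
  qed
  show ?case using one two by simp
qed

section \<open>Involution of a system with isothermic structure equations\<close>

text \<open>The entries \<open>0, \<dots>, 7\<close> stand for \<open>\<alpha>\<^sup>1\<^sub>0\<close>, \<open>\<alpha>\<^sup>2\<^sub>0\<close>, \<open>\<alpha>\<^sup>3\<^sub>1\<close>, \<open>\<alpha>\<^sup>3\<^sub>2\<close>, \<open>\<alpha>\<^sup>4\<^sub>1\<close>, \<open>\<alpha>\<^sup>4\<^sub>2\<close>,
  \<open>\<alpha>\<^sup>0\<^sub>1 - \<beta>\<^sup>0\<^sub>1\<close>, \<open>\<alpha>\<^sup>0\<^sub>2 - \<beta>\<^sup>0\<^sub>2\<close>, evaluated on two vectors. With \<open>\<phi>\<close> the first two and \<open>\<eta>\<close>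
  the last two entries, \<open>h\<^sup>a = (\<alpha>\<^sup>a\<^sub>1, \<alpha>\<^sup>a\<^sub>2)\<close> and \<open>J\<close> the rotation by a right angle, the relations
  say that the 2-forms \<open>h\<^sup>a \<and> \<phi>\<close>, \<open>\<eta> \<and> \<phi>\<close>, \<open>\<eta> \<and> J\<phi>\<close> and \<open>\<eta> \<and> h\<^sup>a\<close> vanish.\<close>

definition isothermic_relations :: "(nat \<Rightarrow> real) \<Rightarrow> (nat \<Rightarrow> real) \<Rightarrow> bool" where
  "isothermic_relations a b \<longleftrightarrow>
     a 2 * b 0 + a 3 * b 1 = b 2 * a 0 + b 3 * a 1 \<and>
     a 4 * b 0 + a 5 * b 1 = b 4 * a 0 + b 5 * a 1 \<and>
     a 6 * b 0 + a 7 * b 1 = b 6 * a 0 + b 7 * a 1 \<and>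
     a 7 * b 0 - a 6 * b 1 = b 7 * a 0 - b 6 * a 1 \<and>
     a 6 * b 2 + a 7 * b 3 = b 6 * a 2 + b 7 * a 3 \<and>
     a 6 * b 4 + a 7 * b 5 = b 6 * a 4 + b 7 * a 5"

lemma isothermic_relations_self: "isothermic_relations a a"
  by (simp add: isothermic_relations_def)

text \<open>Turns openness in the product into the separate distance bounds used by
  \<open>frame_close\<close>.\<close>

lemma open_contains_close_pair:
  fixes S :: "('a::metric_space \<times> 'b::metric_space) set"
  assumes "open S" "(x, v) \<in> S"
  shows "\<exists>\<epsilon>>0. \<forall>x' v'. dist x x' < \<epsilon> \<and> dist v v' < \<epsilon> \<longrightarrow> (x', v') \<in> S"
proof -
  obtain A B where AB: "open A" "open B" "(x, v) \<in> A \<times> B" "A \<times> B \<subseteq> S"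
    using open_prod_elim[OF assms] .
  then obtain d e where de: "d > 0" "ball x d \<subseteq> A" "e > 0" "ball v e \<subseteq> B"
    by (metis mem_Sigma_iff open_contains_ball)
  show ?thesis
    using de AB(4) by (intro exI[of _ "min d e"]) (auto simp: subset_iff)
qed

text \<open>Collects what the Cartan test uses of a chart of the configuration space. Indices 8 to
  22 are the generators and 0 to 7 the coordinates left on their kernel; \<open>torsion\<close>
  concerns pairs of kernel vectors only, that is, structure equations modulo the generators.\<close>

locale isothermic_coframe =
  fixes W :: "'a::euclidean_space set" and \<kappa> :: "nat \<Rightarrow> 'a dform"
  assumes open_W: "open W" and DIM: "DIM('a) = 23"
    and smooth: "j < 23 \<Longrightarrow> smooth_form W 1 (\<kappa> j)"
    and coframe: "x \<in> W \<Longrightarrow> (\<forall>j<23. \<kappa> j x (\<lambda>_. u) = 0) \<Longrightarrow> u = 0"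
    and torsion: "x \<in> W \<Longrightarrow> (\<forall>j\<in>{8..<23}. \<forall>i<2. \<kappa> j x (\<lambda>_. e i) = 0) \<Longrightarrow>
      (\<forall>j\<in>{8..<23}. ext_deriv 1 (\<kappa> j) x e = 0) \<longleftrightarrow>
      isothermic_relations (\<lambda>j. \<kappa> j x (\<lambda>_. e 0)) (\<lambda>j. \<kappa> j x (\<lambda>_. e 1))"
begin

abbreviation "I \<equiv> diff_ideal W (\<kappa> ` {8..<23})"

definition coef :: "nat \<Rightarrow> 'a \<Rightarrow> 'a \<Rightarrow> real" where
  "coef j x u = \<kappa> j x (\<lambda>_. u)"

definition kernel :: "'a \<Rightarrow> 'a set" where
  "kernel x = {u. \<forall>j\<in>{8..<23}. coef j x u = 0}"

definition compatible :: "'a \<Rightarrow> 'a \<Rightarrow> 'a \<Rightarrow> bool" where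
  "compatible x u v \<longleftrightarrow> isothermic_relations (\<lambda>j. coef j x u) (\<lambda>j. coef j x v)"

text \<open>The determinant of the pairs (\<alpha>^1_0, \<alpha>^2_0) and (\<alpha>^0_1 -
  \<beta>^0_1, \<alpha>^0_2 - \<beta>^0_2), both evaluated on \<open>v\<close>.\<close>

definition disc :: "'a \<Rightarrow> 'a \<Rightarrow> real" where
  "disc x v = coef 0 x v * coef 7 x v - coef 1 x v * coef 6 x v"

section \<open>The coframe as coordinates on tangent spaces\<close>

lemma \<kappa>_coef: "j < 23 \<Longrightarrow> x \<in> W \<Longrightarrow> \<kappa> j x v = coef j x (v 0)"
  unfolding coef_def using smooth by (rule smooth_form_1_const)

lemma linear_coef: "j < 23 \<Longrightarrow> x \<in> W \<Longrightarrow> linear (coef j x)"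
  unfolding coef_def using smooth by (rule smooth_form_1_linear)

lemma coef_simps:
  assumes "j < 23" "x \<in> W"
  shows "coef j x 0 = 0" "coef j x (u + v) = coef j x u + coef j x v" "coef j x (c *\<^sub>R u) = c * coef j x u"
    "coef j x (u - v) = coef j x u - coef j x v"
  using linear_coef[OF assms] by (simp_all add: linear_0 linear_add linear_scale linear_diff)

lemma exists_coef: "x \<in> W \<Longrightarrow> \<exists>u. \<forall>j<23. coef j x u = f j"
  using functionals_surjective[of "\<lambda>j. coef j x" f] linear_coef coframe unfolding coef_def DIM by blast

lemma exists_kernel: "x \<in> W \<Longrightarrow> \<exists>u\<in>kernel x. \<forall>j<8. coef j x u = f j"
  using exists_coef[of x "\<lambda>j. if j < 8 then f j else 0"] unfolding kernel_def by force

lemma kernel_zero: "x \<in> W \<Longrightarrow> u \<in> kernel x \<Longrightarrow> (\<forall>j<8. coef j x u = 0) \<Longrightarrow> u = 0"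
  by (rule coframe) (auto simp: kernel_def coef_def not_less[symmetric])

lemma subspace_kernel: "x \<in> W \<Longrightarrow> subspace (kernel x)"
  unfolding kernel_def by (rule subspaceI) (simp_all add: coef_simps)

lemma dim_kernel: "x \<in> W \<Longrightarrow> dim (kernel x) = 8"
  by (rule dim_eq_functionals[where c = "\<lambda>j. coef j x"])
    (simp_all add: subspace_kernel linear_coef kernel_zero exists_kernel)

text \<open>Expansion of the vector over \<open>Basis\<close> reduces joint continuity to continuity
  in the base point; it is what makes nonvanishing an open condition on frames.\<close>

lemma continuous_coef: "j < 23 \<Longrightarrow> continuous_on (W \<times> UNIV) (\<lambda>z. coef j (fst z) (snd z))"
proof -
  assume j: "j < 23"
  have "coef j (fst z) (snd z) = (\<Sum>b\<in>Basis. (snd z \<bullet> b) * coef j (fst z) b)" if "z \<in> W \<times> UNIV" for z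
  proof -
    have x: "fst z \<in> W" using that by auto
    have "coef j (fst z) (\<Sum>b\<in>Basis. (snd z \<bullet> b) *\<^sub>R b) = (\<Sum>b\<in>Basis. (snd z \<bullet> b) * coef j (fst z) b)"
      by (simp only: linear_sum[OF linear_coef[OF j x]] coef_simps[OF j x])
    then show ?thesis by (simp add: euclidean_representation)
  qed
  moreover have "continuous_on (W \<times> UNIV) (\<lambda>z. \<Sum>b\<in>Basis. (snd z \<bullet> b) * coef j (fst z) b)"
  proof (intro continuous_intros)
    fix b :: 'a
    have "continuous_on W (\<lambda>x. coef j x b)"
      using smooth[OF j] smooth_on_continuous unfolding coef_def smooth_form_def by blast
    then show "continuous_on (W \<times> UNIV) (\<lambda>z. coef j (fst z) b)"
      by (rule continuous_on_compose2[OF _ continuous_on_fst[OF continuous_on_id]]) auto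
  qed
  ultimately show ?thesis using continuous_on_cong by (metis (no_types, lifting))
qed

lemma nonzero_nearby:
  assumes "continuous_on (W \<times> UNIV) (\<lambda>z. g (fst z) (snd z))" "x \<in> W" "g x v \<noteq> (0::real)"
  shows "\<exists>\<epsilon>>0. \<forall>x' v'. dist x x' < \<epsilon> \<and> dist v (v'::'a) < \<epsilon> \<longrightarrow> x' \<in> W \<and> g x' v' \<noteq> 0"
proof -
  have "open (W \<times> UNIV \<inter> (\<lambda>z. g (fst z) (snd z)) -` (- {0}))"
    using open_W by (intro continuous_open_preimage[OF assms(1)] open_Times) auto
  from open_contains_close_pair[OF this, of x v] show ?thesis using assms(2,3) by auto
qed

section \<open>The ideal on kernel vectors and the polar spaces\<close>

lemma ideal_0: "I 0 \<phi> \<Longrightarrow> \<phi> x v = 0"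
  using diff_ideal_low_degree[OF open_W _ smooth, of "{8..<23}" "\<lambda>j. j" 0 \<phi>] by simp

lemma ideal_1: "I 1 \<phi> \<Longrightarrow> \<exists>c. \<forall>x\<in>W. \<forall>v. \<phi> x v = (\<Sum>j\<in>{8..<23}. c j x * \<kappa> j x v)"
  using diff_ideal_low_degree[OF open_W _ smooth, of "{8..<23}" "\<lambda>j. j" 1 \<phi>] by (simp, blast)

lemma ideal_1_kernel: "I 1 \<phi> \<Longrightarrow> x \<in> W \<Longrightarrow> v 0 \<in> kernel x \<Longrightarrow> \<phi> x v = 0"
  by (drule ideal_1) (auto simp: kernel_def \<kappa>_coef)

lemma ideal_2:
  assumes "I 2 \<phi>" "x \<in> W" "e 0 \<in> kernel x" "e 1 \<in> kernel x" "compatible x (e 0) (e 1)"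
  shows "\<phi> x e = 0"
proof -
  have K: "\<forall>j\<in>{8..<23}. \<forall>i<2. \<kappa> j x (\<lambda>_. e i) = 0"
    using assms(3,4) by (auto simp: kernel_def coef_def less_2_cases_iff)
  moreover have "\<forall>j\<in>{8..<23}. ext_deriv 1 (\<kappa> j) x e = 0"
    using torsion[OF assms(2) K] assms(5) by (simp add: compatible_def coef_def)
  ultimately show ?thesis
    using diff_ideal_low_degree[OF open_W _ smooth, of "{8..<23}" "\<lambda>j. j" 2 \<phi>] assms(1,2) by simp
qed

lemma generator: "j \<in> {8..<23} \<Longrightarrow> I 1 (\<kappa> j)"
  by (rule diff_ideal.gen) simp

lemma polar_space_0: "x \<in> W \<Longrightarrow> polar_space I 0 x {0} = kernel x"
proof (intro equalityI subsetI)
  fix v assume x: "x \<in> W"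
  { assume v: "v \<in> polar_space I 0 x {0}"
    show "v \<in> kernel x" unfolding kernel_def
    proof (intro CollectI ballI)
      fix j :: nat assume j: "j \<in> {8..<23}"
      have "\<kappa> j x (case_nat v (\<lambda>_. 0)) = 0"
        using v generator[OF j] unfolding polar_space_def by simp
      then show "coef j x v = 0" using j x by (simp add: \<kappa>_coef)
    qed }
  assume "v \<in> kernel x"
  then show "v \<in> polar_space I 0 x {0}"
    unfolding polar_space_def using x ideal_1_kernel by (simp add: ideal_1_kernel)
qed

lemma integral_0: "integral_element I 0 x {0}"
  unfolding integral_element_def using ideal_0 by (simp add: subspace_single_0)

lemma integral_1_iff:
  assumes "x \<in> W"
  shows "integral_element I 1 x (span {v}) \<longleftrightarrow> v \<in> kernel x \<and> v \<noteq> 0"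
proof
  assume I1: "integral_element I 1 x (span {v})"
  then have "v \<noteq> 0" by (auto simp: integral_element_def)
  moreover have "coef j x v = 0" if j: "j \<in> {8..<23}" for j
  proof -
    have "\<kappa> j x (\<lambda>_. v) = 0"
      using I1 generator[OF j] unfolding integral_element_def
      by (elim conjE allE[of _ 1] allE[of _ "\<kappa> j"]) (simp add: span_base)
    then show ?thesis by (simp add: coef_def)
  qed
  ultimately show "v \<in> kernel x \<and> v \<noteq> 0" by (simp add: kernel_def)
next
  assume v: "v \<in> kernel x \<and> v \<noteq> 0"
  have "\<phi> x e = 0" if n: "n \<le> 1" and \<phi>: "I n \<phi>" and e: "\<forall>i. e i \<in> span {v}" for n \<phi> e
  proof (cases "n = 0")
    case True
    then show ?thesis using \<phi> ideal_0 by simp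
  next
    case False
    then have "I 1 \<phi>" using n \<phi> by (metis One_nat_def le_SucE le_zero_eq)
    moreover have "e 0 \<in> kernel x"
      using e v span_minimal[of "{v}" "kernel x"] subspace_kernel[OF assms] by auto
    ultimately show ?thesis using assms ideal_1_kernel by simp
  qed
  then show "integral_element I 1 x (span {v})"
    unfolding integral_element_def using v by (simp add: dim_singleton)
qed

text \<open>Exterior derivatives of generators yield the bilinear relations, and products of
  generators with a 1-form force \<open>w\<close> into the kernel. For the converse, the relations
  are homogeneous in \<open>v\<close>, so they hold with every vector of the line.\<close>

lemma polar_space_1:
  assumes x: "x \<in> W" and v: "v \<in> kernel x" "v \<noteq> 0"
  shows "polar_space I 1 x (span {v}) = {w \<in> kernel x. compatible x w v}"
proof (intro equalityI subsetI)
  fix w assume w: "w \<in> polar_space I 1 x (span {v})"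
  have van: "\<phi> x (case_nat w (\<lambda>_. v)) = 0" if "I 2 \<phi>" for \<phi>
    using w that unfolding polar_space_def by (simp add: numeral_2_eq_2 span_base)
  have "coef j x w = 0" if j: "j \<in> {8..<23}" for j
  proof -
    \<comment> \<open>The 1-form dual to \<open>v\<close>: since \<open>\<kappa> j\<close> vanishes
      on \<open>v\<close>, the wedge of the two on the pair (w, v) is -|v|^2 times the value of
      \<open>\<kappa> j\<close> on \<open>w\<close>.\<close>
    have c: "smooth_form W 1 (\<lambda>y e. e 0 \<bullet> v)"
    proof -
      have "Ck_on n W (\<lambda>y. c)" for n and c :: real
        by (induction n arbitrary: c) simp_all
      moreover have "alternating_form 1 (\<lambda>e. e 0 \<bullet> v)"
        by (rule alternating_form_1I[of "\<lambda>u. u \<bullet> v"]) (auto intro: linearI simp: inner_left_distrib)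
      ultimately show ?thesis by (simp add: smooth_form_def smooth_on_def)
    qed
    have "I 2 (wedge 1 1 (\<lambda>y e. e 0 \<bullet> v) (\<kappa> j))"
      using diff_ideal.mult[OF c generator[OF j]] by (simp add: numeral_2_eq_2)
    from van[OF this] have "(w \<bullet> v) * coef j x v - (v \<bullet> v) * coef j x w = 0"
      unfolding wedge_1_1 using j x by (simp add: \<kappa>_coef)
    then show ?thesis using v j by (simp add: kernel_def)
  qed
  then have wK: "w \<in> kernel x" by (simp add: kernel_def)
  let ?e = "case_nat w (\<lambda>_. v)"
  have K: "\<forall>j\<in>{8..<23}. \<forall>i<2. \<kappa> j x (\<lambda>_. ?e i) = 0"
    using v wK by (auto simp: kernel_def coef_def less_2_cases_iff)
  have "\<forall>j\<in>{8..<23}. ext_deriv 1 (\<kappa> j) x ?e = 0"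
    using van diff_ideal.deriv[OF generator] by (simp add: numeral_2_eq_2)
  then show "w \<in> {w \<in> kernel x. compatible x w v}"
    using torsion[OF x K] wK by (simp add: compatible_def coef_def)
next
  fix w assume w: "w \<in> {w \<in> kernel x. compatible x w v}"
  have "\<phi> x (case_nat w e) = 0" if \<phi>: "I 2 \<phi>" and e: "\<forall>i. e i \<in> span {v}" for \<phi> e
  proof -
    obtain c where c: "e 0 = c *\<^sub>R v" using e by (auto simp: span_singleton)
    have "compatible x w v" using w by simp
    then have "compatible x w (c *\<^sub>R v)"
      unfolding compatible_def isothermic_relations_def using x by (simp add: coef_simps) algebra
    moreover have "c *\<^sub>R v \<in> kernel x" using v subspace_kernel[OF x] by (simp add: subspace_scale)
    ultimately show ?thesis using ideal_2[OF \<phi> x, of "case_nat w e"] w c by simp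
  qed
  then show "w \<in> polar_space I 1 x (span {v})"
    unfolding polar_space_def by (simp add: numeral_2_eq_2)
qed

end

section \<open>Solving the polar equations of a line\<close>

lemma solve_linear_2:
  fixes a b c d p r :: real
  assumes "a * d - b * c \<noteq> 0"
  shows "\<exists>x y. a * x + b * y = p \<and> c * x + d * y = r"
proof (intro exI conjI)
  show "a * ((p * d - b * r) / (a * d - b * c)) + b * ((a * r - c * p) / (a * d - b * c)) = p"
    "c * ((p * d - b * r) / (a * d - b * c)) + d * ((a * r - c * p) / (a * d - b * c)) = r"
    using assms by (simp_all add: divide_simps) (simp_all add: algebra_simps)
qed

lemma linear_2_unique:
  fixes a b c d :: real
  assumes "a * d - b * c \<noteq> 0" "a * x + b * y = 0" "c * x + d * y = 0"
  shows "x = 0 \<and> y = 0"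
proof -
  have "(a * d - b * c) * x = 0" "(a * d - b * c) * y = 0" using assms(2,3) by algebra+
  then show ?thesis using assms(1) by simp
qed

context isothermic_coframe
begin

lemma subspace_compatible: "x \<in> W \<Longrightarrow> subspace {w \<in> kernel x. compatible x w v}"
proof (rule subspaceI)
  assume x: "x \<in> W"
  show "0 \<in> {w \<in> kernel x. compatible x w v}"
    using x subspace_kernel[OF x] by (simp add: compatible_def isothermic_relations_def coef_simps subspace_0)
  show "u + w \<in> {w \<in> kernel x. compatible x w v}" if "u \<in> {w \<in> kernel x. compatible x w v}" "w \<in> {w \<in> kernel x. compatible x w v}" for u w
    using that x subspace_kernel[OF x]
    by (simp add: compatible_def isothermic_relations_def coef_simps subspace_add algebra_simps)
  show "c *\<^sub>R w \<in> {w \<in> kernel x. compatible x w v}" if "w \<in> {w \<in> kernel x. compatible x w v}" for c w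
  proof -
    have "compatible x w v" using that by simp
    then have "compatible x (c *\<^sub>R w) v"
      unfolding compatible_def isothermic_relations_def using x by (simp add: coef_simps) algebra
    then show ?thesis using that subspace_kernel[OF x] by (simp add: subspace_scale)
  qed
qed

text \<open>The six equations are triangular. The third and fourth contain only the unknown
  coordinates 6 and 7, with determinant the sum of the squares of coordinates 0 and 1 of
  \<open>v\<close>. Once these are known, the relations h^a \<and> \<phi> = 0 and \<eta> \<and> h^a
  = 0 determine h^a, with determinant \<open>disc x v\<close>, for each of a = 3 and a = 4.\<close>

lemma exists_compatible:
  assumes x: "x \<in> W" and q: "disc x v \<noteq> 0"
  shows "\<exists>w \<in> {w \<in> kernel x. compatible x w v}. coef 0 x w = a \<and> coef 1 x w = b"
proof -
  have "coef 0 x v \<noteq> 0 \<or> coef 1 x v \<noteq> 0" using q by (auto simp: disc_def)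
  then have N: "coef 0 x v * coef 0 x v - coef 1 x v * (- coef 1 x v) \<noteq> 0"
    by (simp add: sum_squares_eq_zero_iff)
  obtain w6 w7 where w67: "coef 0 x v * w6 + coef 1 x v * w7 = coef 6 x v * a + coef 7 x v * b"
    "- coef 1 x v * w6 + coef 0 x v * w7 = coef 7 x v * a - coef 6 x v * b"
    using solve_linear_2[OF N] by metis
  have q': "coef 0 x v * coef 7 x v - coef 1 x v * coef 6 x v \<noteq> 0" using q by (simp add: disc_def)
  obtain w2 w3 where w23: "coef 0 x v * w2 + coef 1 x v * w3 = coef 2 x v * a + coef 3 x v * b"
    "coef 6 x v * w2 + coef 7 x v * w3 = w6 * coef 2 x v + w7 * coef 3 x v"
    using solve_linear_2[OF q'] by metis
  obtain w4 w5 where w45: "coef 0 x v * w4 + coef 1 x v * w5 = coef 4 x v * a + coef 5 x v * b"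
    "coef 6 x v * w4 + coef 7 x v * w5 = w6 * coef 4 x v + w7 * coef 5 x v"
    using solve_linear_2[OF q'] by metis
  obtain w where w: "w \<in> kernel x" "\<forall>j<8. coef j x w = [a, b, w2, w3, w4, w5, w6, w7] ! j"
    using exists_kernel[OF x] by metis
  then have kw: "coef 0 x w = a" "coef 1 x w = b" "coef 2 x w = w2" "coef 3 x w = w3" "coef 4 x w = w4"
    "coef 5 x w = w5" "coef 6 x w = w6" "coef 7 x w = w7"
    by simp_all
  have "compatible x w v"
    unfolding compatible_def isothermic_relations_def kw using w23 w45 w67 by (simp add: mult.commute)
  then show ?thesis using w(1) kw by blast
qed

text \<open>Uniqueness for the same triangular system, solved in the same order with zero right-hand
  sides.\<close>

lemma compatible_zero:
  assumes x: "x \<in> W" and q: "disc x v \<noteq> 0" and w: "w \<in> kernel x" "compatible x w v" "coef 0 x w = 0" "coef 1 x w = 0"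
  shows "w = 0"
proof (rule kernel_zero[OF x w(1)])
  have "coef 0 x v \<noteq> 0 \<or> coef 1 x v \<noteq> 0" using q by (auto simp: disc_def)
  then have N: "coef 0 x v * coef 0 x v - coef 1 x v * (- coef 1 x v) \<noteq> 0"
    by (simp add: sum_squares_eq_zero_iff)
  have q': "coef 0 x v * coef 7 x v - coef 1 x v * coef 6 x v \<noteq> 0" using q by (simp add: disc_def)
  have w67: "coef 6 x w = 0 \<and> coef 7 x w = 0"
    using w(2) unfolding compatible_def isothermic_relations_def w(3,4)
    by (intro linear_2_unique[OF N]) (simp_all add: algebra_simps)
  have "coef 2 x w = 0 \<and> coef 3 x w = 0"
    using w(2) w67 unfolding compatible_def isothermic_relations_def w(3,4)
    by (intro linear_2_unique[OF q']) (simp_all add: algebra_simps)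
  moreover have "coef 4 x w = 0 \<and> coef 5 x w = 0"
    using w(2) w67 unfolding compatible_def isothermic_relations_def w(3,4)
    by (intro linear_2_unique[OF q']) (simp_all add: algebra_simps)
  ultimately show "\<forall>j<8. coef j x w = 0"
    using w(3,4) w67 by (simp add: less_Suc_eq numeral_eq_Suc)
qed

lemma dim_compatible:
  assumes x: "x \<in> W" and q: "disc x v \<noteq> 0"
  shows "dim {w \<in> kernel x. compatible x w v} = 2"
proof (rule dim_eq_functionals[where c = "\<lambda>j. coef j x"])
  show "u = 0" if "u \<in> {w \<in> kernel x. compatible x w v}" "\<forall>j<2. coef j x u = 0" for u
    using that by (intro compatible_zero[OF x q]) auto
  show "\<exists>u\<in>{w \<in> kernel x. compatible x w v}. \<forall>j<2. coef j x u = (if j = i then 1 else 0)" if "i < 2" for i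
    using exists_compatible[OF x q, of "if i = 0 then 1 else 0" "if i = 1 then 1 else 0"]
    by (auto simp: less_2_cases_iff)
qed (use x subspace_compatible linear_coef in auto)

lemma ext_rank_1:
  assumes x: "x \<in> W" and v: "v \<in> kernel x" and q: "disc x v \<noteq> 0"
  shows "ext_rank I 1 x (span {v}) = 0"
proof -
  have "v \<noteq> 0" using q x by (auto simp: disc_def coef_simps)
  then show ?thesis
    using polar_space_1[OF x v] dim_compatible[OF x q] by (simp add: ext_rank_def)
qed

text \<open>This determines the polar codimension on every regular line, also on those where
  \<open>disc\<close> vanishes: regularity makes it locally constant.\<close>

lemma disc_dense:
  assumes x: "x \<in> W" and v: "v \<in> kernel x" and "\<epsilon> > 0"
  shows "\<exists>v'\<in>kernel x. dist v v' < \<epsilon> \<and> disc x v' \<noteq> 0"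
proof (cases "disc x v = 0")
  case False
  then show ?thesis using v \<open>\<epsilon> > 0\<close> by (intro bexI[of _ v]) auto
next
  case True
  obtain z where z: "z \<in> kernel x" "\<forall>j<8. coef j x z = (if j = 0 \<or> j = 7 then 1 else 0)"
    using exists_kernel[OF x, of "\<lambda>j. if j = 0 \<or> j = 7 then 1 else 0"] by blast
  \<comment> \<open>The direction \<open>z\<close> adds \<open>t\<close> to coordinates 0 and 7 and
    leaves 1 and 6 alone, so \<open>disc\<close> along the line is a monic quadratic in
    \<open>t\<close>. Its constant term \<open>disc x v\<close> is zero in this case, which leaves
    the roots 0 and \<open>- B\<close>.\<close>
  define B where "B = coef 0 x v + coef 7 x v"
  have qt: "disc x (v + t *\<^sub>R z) = t * (B + t)" for t
    using True z(2) x by (simp add: disc_def coef_simps B_def algebra_simps)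
  define \<delta> where "\<delta> = \<epsilon> / (norm z + 1)"
  have \<delta>: "\<delta> > 0" "\<delta> * norm z < \<epsilon>"
    using \<open>\<epsilon> > 0\<close> by (simp_all add: \<delta>_def divide_simps add_nonneg_pos add_pos_nonneg)
  \<comment> \<open>At most one of \<open>\<delta>\<close> and \<open>\<delta> / 2\<close> is the
    root \<open>- B\<close>.\<close>
  obtain t where t: "0 < t" "t \<le> \<delta>" "B + t \<noteq> 0"
  proof (cases "B + \<delta> = 0")
    case True
    then show ?thesis using \<delta>(1) that[of "\<delta> / 2"] by auto
  next
    case False
    then show ?thesis using \<delta>(1) that[of \<delta>] by auto
  qed
  have "dist v (v + t *\<^sub>R z) = t * norm z" using t by (simp add: dist_norm)
  also have "\<dots> \<le> \<delta> * norm z" using t by (intro mult_right_mono) auto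
  finally have "dist v (v + t *\<^sub>R z) < \<epsilon>" using \<delta> by simp
  moreover have "v + t *\<^sub>R z \<in> kernel x"
    using v z(1) subspace_kernel[OF x] by (simp add: subspace_add subspace_scale)
  moreover have "disc x (v + t *\<^sub>R z) \<noteq> 0" using qt t by simp
  ultimately show ?thesis by blast
qed

section \<open>Ordinary and regular integral elements\<close>

lemma kaehler_ordinary_0:
  assumes x: "x \<in> W"
  shows "kaehler_ordinary W I 0 x {0}"
proof -
  obtain \<epsilon> where \<epsilon>: "\<epsilon> > 0" "ball x \<epsilon> \<subseteq> W" using open_W x open_contains_ball by metis
  have "Ck_on n W (\<lambda>y. c)" for n and c :: real
    by (induction n arbitrary: c) simp_all
  \<comment> \<open>The constant 1 serves as reference 0-form. The zero function is the only one in
    the ideal, so an empty list of equations cuts out the zero set.\<close>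
  then have "smooth_form W 0 (\<lambda>_ _. 1)"
    by (simp add: smooth_form_def alternating_form_def smooth_on_def)
  moreover have "frame_of 0 (\<lambda>_. 0) {0::'a}" by (simp add: frame_of_def)
  ultimately show ?thesis
    unfolding kaehler_ordinary_def using x integral_0 \<epsilon> ideal_0
    by (intro conjI exI[of _ "\<lambda>_ _. 1"] exI[of _ "\<lambda>_. 0"] exI[of _ "[]"] exI[of _ \<epsilon>])
      (auto simp: differentials_independent_def form_ratio_def frame_close_def)
qed

definition generators :: "'a dform list" where
  "generators = map \<kappa> [8..<23]"

lemma length_generators: "length generators = 15"
  and nth_generators: "j < 15 \<Longrightarrow> generators ! j = \<kappa> (8 + j)"
  and set_generators: "set generators = \<kappa> ` {8..<23}"
  by (simp_all add: generators_def del: upt_rec_numeral)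

text \<open>The frame is varied over a fixed base point, in the direction dual to one generator.
  There the denominator \<open>\<kappa> 0\<close> stays constant and a single quotient changes, at
  rate 1 / \<open>coef 0 x (e 0)\<close>.\<close>

lemma differentials_independent_generators:
  assumes x: "x \<in> W" and e: "coef 0 x (e 0) \<noteq> 0"
  shows "differentials_independent (map (form_ratio (\<kappa> 0)) generators) x e"
  unfolding differentials_independent_def
proof (intro allI impI)
  fix c :: "nat \<Rightarrow> real" and i
  assume c: "\<forall>x' e'. (\<Sum>j<length (map (form_ratio (\<kappa> 0)) generators). c j *
            deriv (\<lambda>t::real. (map (form_ratio (\<kappa> 0)) generators ! j) (x + t *\<^sub>R x') (\<lambda>i. e i + t *\<^sub>R e' i)) 0) = 0"
    and i: "i < length (map (form_ratio (\<kappa> 0)) generators)"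
  obtain u where u: "\<forall>j<23. coef j x u = (if j = 8 + i then 1 else 0)"
    using exists_coef[OF x, of "\<lambda>j. if j = 8 + i then 1 else 0"] by blast
  have d: "deriv (\<lambda>t::real. (map (form_ratio (\<kappa> 0)) generators ! j) (x + t *\<^sub>R 0) (\<lambda>i. e i + t *\<^sub>R u)) 0
      = (if j = i then 1 else 0) / coef 0 x (e 0)" if j: "j < 15" for j
  proof -
    have "(map (form_ratio (\<kappa> 0)) generators ! j) (x + t *\<^sub>R 0) (\<lambda>i. e i + t *\<^sub>R u)
        = (coef (8 + j) x (e 0) + t * (if j = i then 1 else 0)) / coef 0 x (e 0)" for t
      using j x u by (simp add: nth_generators length_generators form_ratio_def \<kappa>_coef coef_simps)
    moreover have "((\<lambda>t. (coef (8 + j) x (e 0) + t * (if j = i then 1 else 0)) / coef 0 x (e 0))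
        has_real_derivative (if j = i then 1 else 0) / coef 0 x (e 0)) (at 0)"
      using e by (auto intro!: derivative_eq_intros)
    ultimately show ?thesis by (simp only: DERIV_imp_deriv)
  qed
  have "(\<Sum>j<15. c j * ((if j = i then 1 else 0) / coef 0 x (e 0))) = 0"
    using c[THEN spec[of _ 0], THEN spec[of _ "\<lambda>_. u"]] d by (simp add: length_generators)
  moreover have "c j * ((if j = i then 1 else 0) / coef 0 x (e 0)) = (if j = i then c j / coef 0 x (e 0) else 0)" for j
    by simp
  ultimately have "c i / coef 0 x (e 0) = 0"
    using i by (simp add: sum.delta length_generators)
  then show "c i = 0" using e by simp
qed

text \<open>With \<open>\<kappa> 0\<close> as reference form the 15 generators serve as equations,
  because every 1-form of the ideal vanishes on their common kernel.\<close>

lemma kaehler_ordinary_1: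
  assumes x: "x \<in> W" and v: "v \<in> kernel x" "coef 0 x v \<noteq> 0"
  shows "kaehler_ordinary W I 1 x (span {v})"
proof -
  have v0: "v \<noteq> 0" using v x by (auto simp: coef_simps)
  obtain \<epsilon> where \<epsilon>: "\<epsilon> > 0"
    "\<And>x' v'. dist x x' < \<epsilon> \<Longrightarrow> dist v v' < \<epsilon> \<Longrightarrow> x' \<in> W \<and> coef 0 x' v' \<noteq> 0"
    using nonzero_nearby[OF continuous_coef x v(2)] by auto
  have near: "x' \<in> W \<and> \<kappa> 0 x' e' \<noteq> 0 \<and>
           differentials_independent (map (form_ratio (\<kappa> 0)) generators) x' e' \<and>
           ((\<forall>\<phi>. I 1 \<phi> \<longrightarrow> form_ratio (\<kappa> 0) \<phi> x' e' = 0) \<longleftrightarrow>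
            (\<forall>\<phi>\<in>set generators. form_ratio (\<kappa> 0) \<phi> x' e' = 0))"
    if "frame_close 1 \<epsilon> x (\<lambda>_. v) x' e'" for x' e'
  proof -
    have x': "x' \<in> W" "coef 0 x' (e' 0) \<noteq> 0" using that \<epsilon> by (auto simp: frame_close_def)
    have "form_ratio (\<kappa> 0) \<phi> x' e' = 0 \<longleftrightarrow> \<phi> x' e' = 0" for \<phi>
      using x' by (simp add: form_ratio_def \<kappa>_coef)
    moreover have "(\<forall>\<phi>. I 1 \<phi> \<longrightarrow> \<phi> x' e' = 0) \<longleftrightarrow> (\<forall>\<phi>\<in>set generators. \<phi> x' e' = 0)"
    proof
      assume "\<forall>\<phi>. I 1 \<phi> \<longrightarrow> \<phi> x' e' = 0"
      then show "\<forall>\<phi>\<in>set generators. \<phi> x' e' = 0" using generator by (auto simp: set_generators)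
    next
      assume "\<forall>\<phi>\<in>set generators. \<phi> x' e' = 0"
      then have "e' 0 \<in> kernel x'" using x'(1) by (auto simp: kernel_def \<kappa>_coef set_generators)
      then show "\<forall>\<phi>. I 1 \<phi> \<longrightarrow> \<phi> x' e' = 0" using ideal_1_kernel x'(1) by blast
    qed
    ultimately show ?thesis
      using x' differentials_independent_generators[of x' e', OF x'] by (simp add: \<kappa>_coef)
  qed
  have "frame_of 1 (\<lambda>_. v) (span {v})" using v0 by (simp add: frame_of_def lessThan_Suc)
  moreover have "\<kappa> 0 x (\<lambda>_. v) \<noteq> 0" using v by (simp add: coef_def)
  moreover have "integral_element I 1 x (span {v})" using integral_1_iff[OF x] v(1) v0 by simp
  moreover have "\<forall>\<phi>\<in>set generators. I 1 \<phi>" using generator by (auto simp: set_generators)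
  ultimately show ?thesis
    unfolding kaehler_ordinary_def using x smooth[of 0] \<epsilon>(1) near
    by (intro conjI exI[of _ "\<kappa> 0"] exI[of _ "\<lambda>_. v"] exI[of _ generators] exI[of _ \<epsilon>] allI impI)
      auto
qed

lemma continuous_disc: "continuous_on (W \<times> UNIV) (\<lambda>z. disc (fst z) (snd z))"
  unfolding disc_def by (intro continuous_intros continuous_coef) auto

text \<open>\<open>disc\<close> stays nonzero when base point and vector are perturbed, so all
  nearby integral lines have extension rank 0.\<close>

lemma kaehler_regular_1:
  assumes x: "x \<in> W" and v: "v \<in> kernel x" "coef 0 x v \<noteq> 0" "disc x v \<noteq> 0"
  shows "kaehler_regular W I 1 x (span {v})"
proof -
  have v0: "v \<noteq> 0" using v x by (auto simp: coef_simps)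
  obtain \<epsilon> where \<epsilon>: "\<epsilon> > 0"
    "\<And>x' v'. dist x x' < \<epsilon> \<Longrightarrow> dist v v' < \<epsilon> \<Longrightarrow> x' \<in> W \<and> disc x' v' \<noteq> 0"
    using nonzero_nearby[OF continuous_disc x v(3)] by auto
  have "ext_rank I 1 x' (span (e' ` {..<1})) = ext_rank I 1 x (span {v})"
    if "frame_close 1 \<epsilon> x (\<lambda>_. v) x' e'" "x' \<in> W" "integral_element I 1 x' (span (e' ` {..<1}))" for x' e'
  proof -
    have "disc x' (e' 0) \<noteq> 0" using that(1) \<epsilon>(2) by (simp add: frame_close_def)
    moreover have "e' ` {..<1} = {e' 0}" by (auto simp: lessThan_Suc)
    moreover have "e' 0 \<in> kernel x'"
      using that(3) integral_1_iff[OF that(2)] calculation(2) by simp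
    ultimately show ?thesis
      using ext_rank_1 that(2) x v by simp
  qed
  moreover have "frame_of 1 (\<lambda>_. v) (span {v})" using v0 by (simp add: frame_of_def lessThan_Suc)
  ultimately show ?thesis
    unfolding kaehler_regular_def using kaehler_ordinary_1[OF x v(1,2)] \<epsilon>(1) by blast
qed

lemma in_involution:
  assumes x: "x \<in> W"
  shows "in_involution_at W I 2 (wedge 1 1 (\<kappa> 0) (\<kappa> 1)) x"
proof -
  \<comment> \<open>In the notation of the relations: \<phi> = (1, 0), h = 0 and \<eta> = (0, 1),
    the simplest choice with \<phi> and \<eta> independent.\<close>
  obtain v where v: "v \<in> kernel x" "\<forall>j<8. coef j x v = (if j = 0 \<or> j = 7 then 1 else 0)"
    using exists_kernel[OF x, of "\<lambda>j. if j = 0 \<or> j = 7 then 1 else 0"] by blast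
  then have kv: "coef 0 x v = 1" "coef 1 x v = 0" "coef 2 x v = 0" "coef 3 x v = 0" "coef 4 x v = 0" "coef 5 x v = 0"
    "coef 6 x v = 0" "coef 7 x v = 1"
    by simp_all
  have q: "disc x v \<noteq> 0" by (simp add: disc_def kv)
  have v0: "v \<noteq> 0" using kv x by (auto simp: coef_simps)
  define E where "E = {w \<in> kernel x. compatible x w v}"
  have "\<phi> x e = 0" if n: "n \<le> 2" and \<phi>: "I n \<phi>" and e: "\<forall>i. e i \<in> E" for n \<phi> e
  proof -
    have K: "e i \<in> kernel x" for i using e by (auto simp: E_def)
    \<comment> \<open>Compatibility with this \<open>v\<close> means h = 0 and \<eta> equal to
      \<phi> with its two components exchanged. These linear conditions make any two vectors of
      \<open>E\<close> compatible with each other.\<close>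
    have rel: "coef 2 x (e i) = 0" "coef 3 x (e i) = 0" "coef 4 x (e i) = 0" "coef 5 x (e i) = 0"
      "coef 6 x (e i) = coef 1 x (e i)" "coef 7 x (e i) = coef 0 x (e i)" for i
      using e unfolding E_def compatible_def isothermic_relations_def by (simp_all add: kv kv[simplified])
    have "compatible x (e 0) (e 1)"
      unfolding compatible_def isothermic_relations_def by (simp add: rel algebra_simps)
    moreover have "n = 0 \<or> n = 1 \<or> n = 2" using n by arith
    ultimately show ?thesis using \<phi> ideal_0 ideal_1_kernel ideal_2 x K by blast
  qed
  then have intE: "integral_element I 2 x E"
    unfolding integral_element_def E_def using subspace_compatible[OF x] dim_compatible[OF x q] by simp
  have sub: "span {v} \<subseteq> E"
    unfolding E_def using v subspace_compatible[OF x]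
    by (intro span_minimal) (auto simp: compatible_def isothermic_relations_self)
  define F where "F n = (if n = 0 then {0} else if n = 1 then span {v} else E)" for n :: nat
  have "ordinary_flag W I 2 x F"
    unfolding ordinary_flag_def
  proof (intro conjI allI impI)
    fix n :: nat
    show "integral_element I n x (F n)" if n2: "n \<le> 2"
    proof -
      consider "n = 0" | "n = 1" | "n = 2" using n2 by linarith
      then show ?thesis
        by cases (use integral_0 integral_1_iff[OF x] v v0 intE in \<open>auto simp: F_def\<close>)
    qed
    show "F n \<subseteq> F (Suc n)"
      using sub span_0 by (auto simp: F_def)
    show "kaehler_regular W I n x (F n)" if "1 \<le> n \<and> n < 2"
    proof -
      have "n = 1" using that by arith
      then show ?thesis using kaehler_regular_1[OF x v(1) _ q] kv by (simp add: F_def)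
    qed
  next
    show "kaehler_ordinary W I 0 x {0}" using x by (rule kaehler_ordinary_0)
  qed
  then have "ordinary_element W I 2 x E"
    unfolding ordinary_element_def by (intro exI[of _ F]) (simp add: F_def)
  moreover have "nonzero_on (wedge 1 1 (\<kappa> 0) (\<kappa> 1)) x E"
  proof -
    \<comment> \<open>Prescribing \<phi> = (0, 1) makes the independence form equal to 1 on the pair
      (v, w).\<close>
    obtain w where w: "w \<in> E" "coef 0 x w = 0" "coef 1 x w = 1"
      using exists_compatible[OF x q] unfolding E_def by metis
    have "wedge 1 1 (\<kappa> 0) (\<kappa> 1) x (case_nat v (\<lambda>_. w)) \<noteq> 0"
      unfolding wedge_1_1 using x w kv by (simp add: \<kappa>_coef)
    moreover have "\<forall>i. case_nat v (\<lambda>_. w) i \<in> E"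
      using w sub span_base[of v "{v}"] by (auto split: nat.split)
    ultimately show ?thesis unfolding nonzero_on_def by blast
  qed
  ultimately show ?thesis unfolding in_involution_at_def by blast
qed

lemma general_solution:
  assumes x: "x \<in> W"
  shows "general_solution_depends_on_at W I 2 \<Omega> 6 1 x"
  unfolding general_solution_depends_on_at_def
proof (intro allI impI)
  fix F assume "ordinary_flag W I 2 x F \<and> nonzero_on \<Omega> x (F 2)"
  then have F: "\<And>n. n \<le> 2 \<Longrightarrow> integral_element I n x (F n)" "kaehler_regular W I 1 x (F 1)"
    by (auto simp: ordinary_flag_def)
  have "F 0 = {0}" using F(1)[of 0] by (auto simp: integral_element_def subspace_0)
  then have c0: "polar_codim I 0 x (F 0) = 15"
    using polar_space_0[OF x] dim_kernel[OF x] DIM by (simp add: polar_codim_def)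
  obtain e \<epsilon> where e: "frame_of 1 e (F 1)" "\<epsilon> > 0" and reg: "\<And>x' e'. frame_close 1 \<epsilon> x e x' e' \<Longrightarrow> x' \<in> W \<Longrightarrow>
             integral_element I 1 x' (span (e' ` {..<1})) \<Longrightarrow>
           ext_rank I 1 x' (span (e' ` {..<1})) = ext_rank I 1 x (F 1)"
    using F(2) unfolding kaehler_regular_def by blast
  have im: "e' ` {..<1} = {e' 0}" for e' :: "nat \<Rightarrow> 'a" by (auto simp: lessThan_Suc)
  have "F 1 = span {e 0}" using e(1) unfolding frame_of_def im by simp
  then have "e 0 \<in> kernel x" using F(1)[of 1] integral_1_iff[OF x] by simp
  \<comment> \<open>\<open>disc\<close> may vanish on \<open>F 1\<close> itself. A nearby kernel
    vector over the same base point spans an integral line with nonzero \<open>disc\<close>, and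
    regularity transfers its extension rank to \<open>F 1\<close>.\<close>
  then obtain v where v: "v \<in> kernel x" "dist (e 0) v < \<epsilon>" "disc x v \<noteq> 0"
    using disc_dense[OF x _ e(2)] by blast
  have "v \<noteq> 0" using v x by (auto simp: disc_def coef_simps)
  then have "ext_rank I 1 x (F 1) = ext_rank I 1 x (span {v})"
    using reg[of x "\<lambda>_. v", unfolded im] v e(2) x integral_1_iff[OF x] by (simp add: frame_close_def)
  \<comment> \<open>Extension rank 0 of a line means a polar space of dimension 2, hence of
    codimension 23 - 2.\<close>
  then have c1: "polar_codim I 1 x (F 1) = 21"
    using ext_rank_1[OF x v(1,3)] DIM by (simp add: ext_rank_def polar_codim_def)
  show "cartan_character I 2 x F 1 = int 6 \<and>
        (\<forall>k. 1 < k \<and> k \<le> 2 \<longrightarrow> cartan_character I 2 x F k = 0)"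
  proof (intro conjI allI impI)
    show "cartan_character I 2 x F 1 = int 6" using c0 c1 by (simp add: cartan_character_def)
    fix k :: nat assume "1 < k \<and> k \<le> 2"
    then have "k = 2" by arith
    \<comment> \<open>The top character is 23 - 2 - 21.\<close>
    then show "cartan_character I 2 x F k = 0" using c1 DIM by (simp add: cartan_character_def)
  qed
qed

end

section \<open>Calculus of smooth maps\<close>

text \<open>Openness of \<open>W\<close> lets agreement of the maps pass to their derivatives, and
  so to every order.\<close>

lemma Ck_on_cong:
  assumes "open W" "\<And>x. x \<in> W \<Longrightarrow> f x = g x" "Ck_on k W f"
  shows "Ck_on k W g"
  using assms(2,3)
proof (induction k arbitrary: f g)
  case 0
  then show ?case by (simp cong: continuous_on_cong)
next
  case (Suc k)
  have d: "g differentiable (at x)" if "x \<in> W" for x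
  proof -
    have "(f has_derivative frechet_derivative f (at x)) (at x)"
      using Suc.prems(2) that by (simp add: frechet_derivative_works[symmetric])
    then have "(g has_derivative frechet_derivative f (at x)) (at x)"
      by (rule has_derivative_transform_within_open[OF _ assms(1) that]) (rule Suc.prems(1))
    then show ?thesis by (auto simp: differentiable_def)
  qed
  have "frechet_derivative f (at x) v = frechet_derivative g (at x) v" if "x \<in> W" for x v
    using Suc.prems that assms(1) by (subst frechet_derivative_transform_within_open[of f x W g]) auto
  then have "Ck_on k W (\<lambda>x. frechet_derivative g (at x) v)" for v
    using Suc.prems by (auto intro: Suc.IH[rotated, of "\<lambda>x. frechet_derivative f (at x) v"])
  with d show ?case by simp
qed

lemma Ck_on_Suc_imp: "Ck_on (Suc k) W f \<Longrightarrow> Ck_on k W f"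
proof (induction k arbitrary: f)
  case 0
  then show ?case
    by (auto intro!: differentiable_imp_continuous_on simp: differentiable_on_def differentiable_at_withinI)
next
  case (Suc k)
  then show ?case by (simp del: Ck_on.simps(2) add: Ck_on.simps(2)[of "Suc k"] Ck_on.simps(2)[of k])
qed

lemma Ck_on_add:
  assumes "open W" "Ck_on k W f" "Ck_on k W g"
  shows "Ck_on k W (\<lambda>x. f x + g x)"
  using assms(2,3)
proof (induction k arbitrary: f g)
  case 0
  then show ?case by (simp add: continuous_on_add)
next
  case (Suc k)
  have "Ck_on k W (\<lambda>x. frechet_derivative (\<lambda>x. f x + g x) (at x) v)" for v
  proof (rule Ck_on_cong[OF assms(1)])
    show "Ck_on k W (\<lambda>x. frechet_derivative f (at x) v + frechet_derivative g (at x) v)"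
      using Suc by auto
    show "frechet_derivative f (at x) v + frechet_derivative g (at x) v
        = frechet_derivative (\<lambda>x. f x + g x) (at x) v" if "x \<in> W" for x
    proof -
      have "((\<lambda>x. f x + g x) has_derivative
          (\<lambda>v. frechet_derivative f (at x) v + frechet_derivative g (at x) v)) (at x)"
        using Suc.prems that by (intro has_derivative_add) (simp_all add: frechet_derivative_works[symmetric])
      from frechet_derivative_at[OF this, symmetric] show ?thesis by simp
    qed
  qed
  then show ?case using Suc.prems by auto
qed

lemma Ck_on_bounded_linear:
  assumes "open W" "bounded_linear L" "Ck_on k W f"
  shows "Ck_on k W (\<lambda>x. L (f x))"
  using assms(3)
proof (induction k arbitrary: f)
  case 0
  then show ?case by (simp add: bounded_linear.continuous_on[OF assms(2)])
next
  case (Suc k)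
  have d: "((\<lambda>x. L (f x)) has_derivative (\<lambda>v. L (frechet_derivative f (at x) v))) (at x)" if "x \<in> W" for x
    using Suc.prems that
    by (intro bounded_linear.has_derivative[OF assms(2)]) (simp add: frechet_derivative_works[symmetric])
  have "Ck_on k W (\<lambda>x. frechet_derivative (\<lambda>x. L (f x)) (at x) v)" for v
    by (rule Ck_on_cong[OF assms(1), of "\<lambda>x. L (frechet_derivative f (at x) v)"])
      (use Suc in \<open>auto simp: frechet_derivative_at[OF d, symmetric]\<close>)
  then show ?case using d by (auto simp: differentiable_def)
qed

text \<open>Each summand of the product rule pairs a derivative of one factor with the other factor
  itself, hence the lowering of the order by \<open>Ck_on_Suc_imp\<close>. The intended product is
  matrix multiplication.\<close>

lemma Ck_on_bounded_bilinear:
  assumes "open W" "bounded_bilinear P" "Ck_on k W f" "Ck_on k W g"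
  shows "Ck_on k W (\<lambda>x. P (f x) (g x))"
  using assms(3,4)
proof (induction k arbitrary: f g)
  case 0
  then show ?case by (simp add: bounded_bilinear.continuous_on[OF assms(2)])
next
  case (Suc k)
  have d: "((\<lambda>x. P (f x) (g x)) has_derivative
      (\<lambda>v. P (f x) (frechet_derivative g (at x) v) + P (frechet_derivative f (at x) v) (g x))) (at x)"
    if "x \<in> W" for x
    using Suc.prems that
    by (intro bounded_bilinear.FDERIV[OF assms(2)]) (simp_all add: frechet_derivative_works[symmetric])
  have "Ck_on k W (\<lambda>x. frechet_derivative (\<lambda>x. P (f x) (g x)) (at x) v)" for v
    by (rule Ck_on_cong[OF assms(1),
          of "\<lambda>x. P (f x) (frechet_derivative g (at x) v) + P (frechet_derivative f (at x) v) (g x)"])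
      (use Suc.IH Suc.prems Ck_on_Suc_imp[OF Suc.prems(1)] Ck_on_Suc_imp[OF Suc.prems(2)]
        in \<open>auto simp: frechet_derivative_at[OF d, symmetric] intro: Ck_on_add[OF assms(1)]\<close>)
  then show ?case using d by (auto simp: differentiable_def)
qed

lemma smooth_on_cong:
  "open W \<Longrightarrow> (\<And>x. x \<in> W \<Longrightarrow> f x = g x) \<Longrightarrow> smooth_on W f \<Longrightarrow> smooth_on W g"
  unfolding smooth_on_def using Ck_on_cong by blast

lemma smooth_on_bounded_linear:
  "open W \<Longrightarrow> bounded_linear L \<Longrightarrow> smooth_on W f \<Longrightarrow> smooth_on W (\<lambda>x. L (f x))"
  unfolding smooth_on_def by (simp add: Ck_on_bounded_linear)

lemma smooth_on_bounded_bilinear: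
  "open W \<Longrightarrow> bounded_bilinear P \<Longrightarrow> smooth_on W f \<Longrightarrow> smooth_on W g \<Longrightarrow> smooth_on W (\<lambda>x. P (f x) (g x))"
  unfolding smooth_on_def by (simp add: Ck_on_bounded_bilinear)

lemma smooth_on_diff:
  "open W \<Longrightarrow> smooth_on W f \<Longrightarrow> smooth_on W g \<Longrightarrow> smooth_on W (\<lambda>x. f x - g x)"
  unfolding smooth_on_def
  using Ck_on_add[of W _ f "\<lambda>x. - g x"] Ck_on_bounded_linear[of W "\<lambda>y. - y" _ g]
  by (simp add: bounded_linear_minus bounded_linear_ident)

lemma smooth_on_frechet_derivative:
  assumes "smooth_on W f" shows "smooth_on W (\<lambda>x. frechet_derivative f (at x) v)"
  unfolding smooth_on_def
proof
  fix k
  have "Ck_on (Suc k) W f" using assms by (simp only: smooth_on_def)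
  then show "Ck_on k W (\<lambda>x. frechet_derivative f (at x) v)" by simp
qed

section \<open>Symmetry of second derivatives\<close>

lemma DERIV_along_line:
  fixes f :: "'a::real_normed_vector \<Rightarrow> real"
  assumes "f differentiable (at (y + \<sigma> *\<^sub>R u))"
  shows "((\<lambda>\<sigma>. f (y + \<sigma> *\<^sub>R u)) has_real_derivative frechet_derivative f (at (y + \<sigma> *\<^sub>R u)) u) (at \<sigma>)"
proof -
  let ?D = "frechet_derivative f (at (y + \<sigma> *\<^sub>R u))"
  have D: "(f has_derivative ?D) (at (y + \<sigma> *\<^sub>R u))"
    using assms by (simp add: frechet_derivative_works)
  have "((\<lambda>\<sigma>. y + \<sigma> *\<^sub>R u) has_derivative (\<lambda>h. h *\<^sub>R u)) (at \<sigma>)"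
    by (auto intro!: derivative_eq_intros)
  from has_derivative_compose[OF this D]
  have "((\<lambda>\<sigma>. f (y + \<sigma> *\<^sub>R u)) has_derivative (\<lambda>h. ?D (h *\<^sub>R u))) (at \<sigma>)" .
  moreover have "?D (h *\<^sub>R u) = ?D u * h" for h
    using linear_scale[OF has_derivative_linear[OF D]] by simp
  ultimately show ?thesis by (simp add: has_field_derivative_def)
qed

text \<open>Two applications of the mean value theorem: along \<open>u\<close> to the difference of
  \<open>f\<close> on two parallel segments, then along \<open>v\<close> to the derivative of
  \<open>f\<close> in direction \<open>u\<close>. The ball keeps the whole parallelogram inside
  \<open>W\<close>.\<close>

lemma second_difference:
  fixes f :: "'a::real_normed_vector \<Rightarrow> real"
  assumes f: "smooth_on W f" and s: "s > 0" and W: "ball x (s * (norm u + norm v) + \<delta>) \<subseteq> W" "\<delta> > 0"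
  shows "\<exists>\<sigma> \<tau>. 0 < \<sigma> \<and> \<sigma> < s \<and> 0 < \<tau> \<and> \<tau> < s \<and>
    f (x + s *\<^sub>R u + s *\<^sub>R v) - f (x + s *\<^sub>R u) - f (x + s *\<^sub>R v) + f x
      = s * s * frechet_derivative (\<lambda>y. frechet_derivative f (at y) u) (at (x + \<sigma> *\<^sub>R u + \<tau> *\<^sub>R v)) v"
proof -
  have inW: "x + \<sigma> *\<^sub>R u + \<tau> *\<^sub>R v \<in> W" if "0 \<le> \<sigma>" "\<sigma> \<le> s" "0 \<le> \<tau>" "\<tau> \<le> s" for \<sigma> \<tau>
  proof -
    have "norm (\<sigma> *\<^sub>R u + \<tau> *\<^sub>R v) \<le> \<sigma> * norm u + \<tau> * norm v"
      using that by (intro norm_triangle_le) simp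
    also have "\<dots> \<le> s * norm u + s * norm v"
      using that by (intro add_mono mult_right_mono) auto
    finally have "norm (\<sigma> *\<^sub>R u + \<tau> *\<^sub>R v) < s * (norm u + norm v) + \<delta>"
      using W(2) by (simp add: distrib_left)
    moreover have "dist x (x + z) = norm z" for z by (simp add: dist_norm)
    ultimately have "dist x (x + (\<sigma> *\<^sub>R u + \<tau> *\<^sub>R v)) < s * (norm u + norm v) + \<delta>"
      by simp
    then show ?thesis using W(1) by (auto simp: add.assoc)
  qed
  have fd: "f differentiable (at y)" if "y \<in> W" for y
    using smooth_on_differentiable[OF f that] .
  have fd2: "(\<lambda>y. frechet_derivative f (at y) u) differentiable (at y)" if "y \<in> W" for y
    using smooth_on_differentiable[OF smooth_on_frechet_derivative[OF f] that] .
  have "\<exists>\<sigma>>0. \<sigma> < s \<and>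
      (f ((x + s *\<^sub>R v) + s *\<^sub>R u) - f (x + s *\<^sub>R u)) - (f ((x + s *\<^sub>R v) + 0 *\<^sub>R u) - f (x + 0 *\<^sub>R u))
      = (s - 0) * (frechet_derivative f (at ((x + s *\<^sub>R v) + \<sigma> *\<^sub>R u)) u - frechet_derivative f (at (x + \<sigma> *\<^sub>R u)) u)"
  proof (rule MVT2[OF s])
    fix \<sigma> assume \<sigma>: "0 \<le> \<sigma>" "\<sigma> \<le> s"
    show "((\<lambda>\<sigma>. f ((x + s *\<^sub>R v) + \<sigma> *\<^sub>R u) - f (x + \<sigma> *\<^sub>R u)) has_real_derivative
      frechet_derivative f (at ((x + s *\<^sub>R v) + \<sigma> *\<^sub>R u)) u - frechet_derivative f (at (x + \<sigma> *\<^sub>R u)) u) (at \<sigma>)"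
      using inW[of \<sigma> s] inW[of \<sigma> 0] \<sigma> s
      by (intro DERIV_diff DERIV_along_line fd) (simp_all add: algebra_simps)
  qed
  then obtain \<sigma> where \<sigma>: "0 < \<sigma>" "\<sigma> < s"
    "f (x + s *\<^sub>R u + s *\<^sub>R v) - f (x + s *\<^sub>R u) - f (x + s *\<^sub>R v) + f x
      = s * (frechet_derivative f (at ((x + \<sigma> *\<^sub>R u) + s *\<^sub>R v)) u - frechet_derivative f (at ((x + \<sigma> *\<^sub>R u) + 0 *\<^sub>R v)) u)"
    by (auto simp: algebra_simps)
  have "\<exists>\<tau>>0. \<tau> < s \<and>
      frechet_derivative f (at ((x + \<sigma> *\<^sub>R u) + s *\<^sub>R v)) u - frechet_derivative f (at ((x + \<sigma> *\<^sub>R u) + 0 *\<^sub>R v)) u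
      = (s - 0) * frechet_derivative (\<lambda>y. frechet_derivative f (at y) u) (at ((x + \<sigma> *\<^sub>R u) + \<tau> *\<^sub>R v)) v"
    using \<sigma>(1,2) inW by (intro MVT2[OF s] DERIV_along_line fd2) auto
  then show ?thesis using \<sigma> by auto
qed

text \<open>The second difference is symmetric in \<open>u\<close> and \<open>v\<close>, so the two
  mixed derivatives take a common value at two points of the parallelogram; by continuity they
  differ at \<open>x\<close> by less than any positive bound.\<close>

lemma frechet_derivative_commute_real:
  fixes f :: "'a::real_normed_vector \<Rightarrow> real"
  assumes W: "open W" and f: "smooth_on W f" and x: "x \<in> W"
  shows "frechet_derivative (\<lambda>y. frechet_derivative f (at y) u) (at x) v
    = frechet_derivative (\<lambda>y. frechet_derivative f (at y) v) (at x) u"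
proof -
  define D where "D u v y = frechet_derivative (\<lambda>y. frechet_derivative f (at y) u) (at y) v" for u v y
  have "\<bar>D u v x - D v u x\<bar> < 2 * \<epsilon>" if \<epsilon>: "\<epsilon> > 0" for \<epsilon>
  proof -
    have cont: "isCont (D u v) x" for u v
      unfolding D_def
      using smooth_on_continuous[OF smooth_on_frechet_derivative[OF smooth_on_frechet_derivative[OF f]]] W x
      by (simp add: continuous_on_eq_continuous_at)
    obtain r where r: "r > 0" "ball x r \<subseteq> W" using W x open_contains_ball by metis
    obtain d1 where d1: "d1 > 0" "\<And>y. dist y x < d1 \<Longrightarrow> dist (D u v y) (D u v x) < \<epsilon>"
      using cont[of u v] \<epsilon> unfolding continuous_at_eps_delta by metis
    obtain d2 where d2: "d2 > 0" "\<And>y. dist y x < d2 \<Longrightarrow> dist (D v u y) (D v u x) < \<epsilon>"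
      using cont[of v u] \<epsilon> unfolding continuous_at_eps_delta by metis
    define d where "d = min r (min d1 d2)"
    have d: "d > 0" using r d1 d2 by (simp add: d_def)
    \<comment> \<open>This keeps the parallelogram within distance \<open>d / 2\<close> of
      \<open>x\<close>, leaving \<open>d / 2\<close> for the margin \<delta> of
      \<open>second_difference\<close>; the summand 1 covers \<open>u = v = 0\<close>.\<close>
    define s where "s = d / (2 * (norm u + norm v + 1))"
    have n: "norm u + norm v + 1 > 0" by (simp add: add_nonneg_pos)
    have s: "s > 0" using d n by (simp add: s_def)
    have "s * (norm u + norm v + 1) = d / 2" using n by (simp add: s_def field_simps)
    then have sd: "s * (norm u + norm v) \<le> d / 2" using s by (simp add: algebra_simps)
    have close: "dist (x + \<sigma> *\<^sub>R a + \<tau> *\<^sub>R b) x < d"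
      if "0 < \<sigma>" "\<sigma> < s" "0 < \<tau>" "\<tau> < s" "norm a + norm b = norm u + norm v" for \<sigma> \<tau> a b
    proof -
      have "norm (\<sigma> *\<^sub>R a + \<tau> *\<^sub>R b) \<le> \<sigma> * norm a + \<tau> * norm b"
        using that by (intro norm_triangle_le) simp
      also have "\<dots> \<le> s * norm a + s * norm b"
        using that by (intro add_mono mult_right_mono) auto
      also have "\<dots> = s * (norm u + norm v)" using that(5) by (simp add: distrib_left[symmetric])
      finally show ?thesis using sd d by (simp add: dist_norm add.assoc)
    qed
    have ball: "ball x (s * (norm u + norm v) + d / 2) \<subseteq> W" "ball x (s * (norm v + norm u) + d / 2) \<subseteq> W"
      using sd r(2) by (auto simp: d_def subset_iff add.commute)
    obtain \<sigma> \<tau> where 1: "0 < \<sigma>" "\<sigma> < s" "0 < \<tau>" "\<tau> < s"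
      "f (x + s *\<^sub>R u + s *\<^sub>R v) - f (x + s *\<^sub>R u) - f (x + s *\<^sub>R v) + f x = s * s * D u v (x + \<sigma> *\<^sub>R u + \<tau> *\<^sub>R v)"
      using second_difference[OF f s ball(1)] d unfolding D_def by auto
    obtain \<sigma>' \<tau>' where 2: "0 < \<sigma>'" "\<sigma>' < s" "0 < \<tau>'" "\<tau>' < s"
      "f (x + s *\<^sub>R v + s *\<^sub>R u) - f (x + s *\<^sub>R v) - f (x + s *\<^sub>R u) + f x = s * s * D v u (x + \<sigma>' *\<^sub>R v + \<tau>' *\<^sub>R u)"
      using second_difference[OF f s ball(2)] d unfolding D_def by auto
    have "f (x + s *\<^sub>R v + s *\<^sub>R u) = f (x + s *\<^sub>R u + s *\<^sub>R v)" by (simp add: algebra_simps)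
    then have "s * s * D u v (x + \<sigma> *\<^sub>R u + \<tau> *\<^sub>R v) = s * s * D v u (x + \<sigma>' *\<^sub>R v + \<tau>' *\<^sub>R u)"
      using 1(5) 2(5) by linarith
    then have "D u v (x + \<sigma> *\<^sub>R u + \<tau> *\<^sub>R v) = D v u (x + \<sigma>' *\<^sub>R v + \<tau>' *\<^sub>R u)" using s by simp
    moreover have "dist (D u v (x + \<sigma> *\<^sub>R u + \<tau> *\<^sub>R v)) (D u v x) < \<epsilon>"
      using close[OF 1(1-4), of u v] by (intro d1) (simp add: d_def)
    moreover have "dist (D v u (x + \<sigma>' *\<^sub>R v + \<tau>' *\<^sub>R u)) (D v u x) < \<epsilon>"
      using close[OF 2(1-4), of v u] by (intro d2) (simp add: d_def add.commute)
    ultimately show ?thesis by (simp add: dist_real_def)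
  qed
  from this[of "\<bar>D u v x - D v u x\<bar> / 2"] have "D u v x = D v u x" by force
  then show ?thesis unfolding D_def .
qed

lemma frechet_derivative_bounded_linear:
  assumes "bounded_linear L" "f differentiable (at x)"
  shows "frechet_derivative (\<lambda>y. L (f y)) (at x) v = L (frechet_derivative f (at x) v)"
proof -
  have "((\<lambda>y. L (f y)) has_derivative (\<lambda>v. L (frechet_derivative f (at x) v))) (at x)"
    using assms(2) by (intro bounded_linear.has_derivative[OF assms(1)]) (simp add: frechet_derivative_works[symmetric])
  from frechet_derivative_at[OF this, symmetric] show ?thesis by simp
qed

lemma frechet_derivative_commute:
  fixes f :: "'a::real_normed_vector \<Rightarrow> 'b::euclidean_space"
  assumes W: "open W" and f: "smooth_on W f" and x: "x \<in> W"
  shows "frechet_derivative (\<lambda>y. frechet_derivative f (at y) u) (at x) v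
    = frechet_derivative (\<lambda>y. frechet_derivative f (at y) v) (at x) u"
proof (rule euclidean_eqI)
  fix b :: 'b
  have bl: "bounded_linear (\<lambda>z. z \<bullet> b)" by (rule bounded_linear_inner_left)
  have D: "frechet_derivative (\<lambda>y. frechet_derivative f (at y) u) (at x) v \<bullet> b
      = frechet_derivative (\<lambda>y. frechet_derivative (\<lambda>y. f y \<bullet> b) (at y) u) (at x) v" for u v
  proof -
    have "frechet_derivative (\<lambda>y. frechet_derivative f (at y) u) (at x) v \<bullet> b
        = frechet_derivative (\<lambda>y. frechet_derivative f (at y) u \<bullet> b) (at x) v"
      using smooth_on_differentiable[OF smooth_on_frechet_derivative[OF f] x]
      by (simp add: frechet_derivative_bounded_linear[OF bl])
    also have "\<dots> = frechet_derivative (\<lambda>y. frechet_derivative (\<lambda>y. f y \<bullet> b) (at y) u) (at x) v"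
    proof (subst frechet_derivative_transform_within_open[OF _ W x])
      show "(\<lambda>y. frechet_derivative f (at y) u \<bullet> b) differentiable (at x)"
        using smooth_on_differentiable[OF smooth_on_bounded_linear[OF W bl smooth_on_frechet_derivative[OF f]] x] .
      show "frechet_derivative f (at y) u \<bullet> b = frechet_derivative (\<lambda>y. f y \<bullet> b) (at y) u" if "y \<in> W" for y
        using frechet_derivative_bounded_linear[OF bl smooth_on_differentiable[OF f that]] by simp
    qed simp
    finally show ?thesis .
  qed
  show "frechet_derivative (\<lambda>y. frechet_derivative f (at y) u) (at x) v \<bullet> b
    = frechet_derivative (\<lambda>y. frechet_derivative f (at y) v) (at x) u \<bullet> b"
    unfolding D using W smooth_on_bounded_linear[OF W bl f] x by (rule frechet_derivative_commute_real)
qed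

section \<open>The Maurer-Cartan equation for matrix-valued maps\<close>

lemma bounded_bilinear_matrix_mult:
  "bounded_bilinear ((**) :: real^'n^'m \<Rightarrow> real^'p^'n \<Rightarrow> real^'p^'m)"
proof -
  have "bilinear ((**) :: real^'n^'m \<Rightarrow> real^'p^'n \<Rightarrow> real^'p^'m)"
    unfolding bilinear_def
    by (auto intro!: linearI simp: matrix_matrix_mult_def vec_eq_iff algebra_simps sum.distrib sum_distrib_left)
  then show ?thesis by (simp add: bilinear_conv_bounded_bilinear)
qed

lemma matrix_inv_eqI:
  fixes A :: "real^'n^'n"
  assumes "B ** A = mat 1"
  shows "matrix_inv A = B"
proof -
  have "A ** B = mat 1" using assms by (simp add: matrix_left_right_inverse)
  then have "A ** matrix_inv A = mat 1"
    unfolding matrix_inv_def using assms by (metis (mono_tags, lifting) someI_ex)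
  then have "B ** (A ** matrix_inv A) = B" by simp
  then show ?thesis using assms by (simp add: matrix_mul_assoc)
qed

text \<open>Differentiating \<open>M y ** A y = mat 1\<close> gives dM = - (M dA) M, and the second
  derivatives of \<open>A\<close> cancel by symmetry. The inverse appears as a separate map
  \<open>M\<close>, so that its smoothness can be supplied.\<close>

lemma maurer_cartan_equation:
  fixes A M :: "'a::real_normed_vector \<Rightarrow> real^'n^'n"
  assumes W: "open W" and A: "smooth_on W A" and M: "smooth_on W M" and x: "x \<in> W"
    and inv: "\<And>y. y \<in> W \<Longrightarrow> M y ** A y = mat 1"
  shows "frechet_derivative (\<lambda>y. M y ** frechet_derivative A (at y) v) (at x) u
       - frechet_derivative (\<lambda>y. M y ** frechet_derivative A (at y) u) (at x) v
     = - ((M x ** frechet_derivative A (at x) u) ** (M x ** frechet_derivative A (at x) v)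
        - (M x ** frechet_derivative A (at x) v) ** (M x ** frechet_derivative A (at x) u))"
proof -
  note bb = bounded_bilinear_matrix_mult
  let ?A' = "\<lambda>u. frechet_derivative A (at x) u" and ?M' = "\<lambda>u. frechet_derivative M (at x) u"
  have dM: "(M has_derivative ?M') (at x)" and dA: "(A has_derivative ?A') (at x)"
    using smooth_on_differentiable[OF M x] smooth_on_differentiable[OF A x]
    by (simp_all add: frechet_derivative_works)
  have dA': "((\<lambda>y. frechet_derivative A (at y) v) has_derivative
      frechet_derivative (\<lambda>y. frechet_derivative A (at y) v) (at x)) (at x)" for v
    using smooth_on_differentiable[OF smooth_on_frechet_derivative[OF A] x]
    by (simp add: frechet_derivative_works)
  have "((\<lambda>y. M y ** A y) has_derivative (\<lambda>u. M x ** ?A' u + ?M' u ** A x)) (at x)"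
    by (rule bounded_bilinear.FDERIV[OF bb dM dA])
  moreover have "((\<lambda>y. M y ** A y) has_derivative (\<lambda>u. 0)) (at x)"
    by (rule has_derivative_transform_within_open[OF has_derivative_const W x, of "mat 1"]) (simp add: inv)
  ultimately have "(\<lambda>u. M x ** ?A' u + ?M' u ** A x) = (\<lambda>u. 0)"
    by (rule has_derivative_unique)
  then have "M x ** ?A' u + ?M' u ** A x = 0" for u by (rule fun_cong)
  then have "?M' u ** A x = - (M x ** ?A' u)" for u by (simp add: eq_neg_iff_add_eq_0 add.commute)
  then have "(?M' u ** A x) ** M x = - (M x ** ?A' u) ** M x" for u by simp
  moreover have "A x ** M x = mat 1" using inv[OF x] by (simp add: matrix_left_right_inverse)
  ultimately have M': "?M' u = - (M x ** ?A' u) ** M x" for u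
    by (simp add: matrix_mul_assoc[symmetric])
  have d: "frechet_derivative (\<lambda>y. M y ** frechet_derivative A (at y) v) (at x) u
      = M x ** frechet_derivative (\<lambda>y. frechet_derivative A (at y) v) (at x) u + ?M' u ** ?A' v" for u v
    using frechet_derivative_at[OF bounded_bilinear.FDERIV[OF bb dM dA'], symmetric] by simp
  show ?thesis
    unfolding d M' frechet_derivative_commute[OF W A x, of v u]
    by (simp add: bounded_bilinear.minus_left[OF bb] matrix_mul_assoc)
qed

lemma smooth_form_1_diff:
  assumes "open W" "smooth_form W 1 \<phi>" "smooth_form W 1 \<psi>"
  shows "smooth_form W 1 (\<phi> - \<psi>)"
  unfolding smooth_form_def
proof (intro conjI ballI allI)
  fix w assume w: "w \<in> W"
  show "alternating_form 1 ((\<phi> - \<psi>) w)"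
  proof (rule alternating_form_1I)
    show "linear (\<lambda>u. \<phi> w (\<lambda>_. u) - \<psi> w (\<lambda>_. u))"
      using smooth_form_1_linear[OF assms(2) w] smooth_form_1_linear[OF assms(3) w]
      by (rule linear_compose_sub)
    show "(\<phi> - \<psi>) w v = \<phi> w (\<lambda>_. v 0) - \<psi> w (\<lambda>_. v 0)" for v
      using smooth_form_1_const[OF assms(2) w, of v] smooth_form_1_const[OF assms(3) w, of v] by simp
  qed
next
  fix v
  have "smooth_on W (\<lambda>y. \<phi> y v - \<psi> y v)"
    using assms by (intro smooth_on_diff) (simp_all add: smooth_form_def)
  then show "smooth_on W (\<lambda>y. (\<phi> - \<psi>) y v)" by simp
qed

lemma ext_deriv_1_diff:
  assumes "open W" "smooth_form W 1 \<phi>" "smooth_form W 1 \<psi>" "w \<in> W"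
  shows "ext_deriv 1 (\<phi> - \<psi>) w e = ext_deriv 1 \<phi> w e - ext_deriv 1 \<psi> w e"
proof -
  have "frechet_derivative (\<lambda>y. (\<phi> - \<psi>) y v) (at w) u
      = frechet_derivative (\<lambda>y. \<phi> y v) (at w) u - frechet_derivative (\<lambda>y. \<psi> y v) (at w) u" for u v
  proof -
    have "((\<lambda>y. \<phi> y v) has_derivative frechet_derivative (\<lambda>y. \<phi> y v) (at w)) (at w)"
      "((\<lambda>y. \<psi> y v) has_derivative frechet_derivative (\<lambda>y. \<psi> y v) (at w)) (at w)"
      using smooth_form_1_differentiable[OF assms(2,4)] smooth_form_1_differentiable[OF assms(3,4)]
      by (simp_all add: frechet_derivative_works[symmetric])
    from frechet_derivative_at[OF has_derivative_diff[OF this], symmetric] show ?thesis by simp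
  qed
  then show ?thesis unfolding ext_deriv_1 by simp
qed

section \<open>The Maurer-Cartan form of the orthogonal group\<close>

lemma UNIV_6: "(UNIV :: 6 set) = {0, 1, 2, 3, 4, 5}"
proof -
  have "card {0, 1, 2, 3, 4, 5 :: 6} = card (UNIV :: 6 set)" by simp
  then show ?thesis by (metis card_subset_eq finite subset_UNIV)
qed

lemma sum_6: "(\<Sum>i\<in>UNIV. f (i::6)) = f 0 + f 1 + f 2 + f 3 + f 4 + (f 5 :: 'a::comm_monoid_add)"
  unfolding UNIV_6 by (simp add: add.assoc)

lemma forall_6: "(\<forall>i::6. P i) \<longleftrightarrow> P 0 \<and> P 1 \<and> P 2 \<and> P 3 \<and> P 4 \<and> P 5"
  using UNIV_6 by (metis (full_types) UNIV_I empty_iff insert_iff)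

definition gram42 :: "real^6^6" where
  "gram42 = (\<chi> i j. ip42 (axis i 1) (axis j 1))"

lemma gram42_mult_vec:
  "(gram42 *v y) $ 0 = - y $ 5" "(gram42 *v y) $ 1 = y $ 1" "(gram42 *v y) $ 2 = y $ 2"
  "(gram42 *v y) $ 3 = y $ 3" "(gram42 *v y) $ 4 = - y $ 4" "(gram42 *v y) $ 5 = - y $ 0"
  by (simp_all add: matrix_vector_mult_def sum_6 gram42_def ip42_def axis_def)

lemma ip42_gram: "ip42 x y = x \<bullet> (gram42 *v y)"
  by (simp add: inner_vec_def sum_6 gram42_mult_vec ip42_def algebra_simps)

lemma gram42_mult:
  "(gram42 ** A) $ 0 $ j = - A $ 5 $ j" "(gram42 ** A) $ 1 $ j = A $ 1 $ j" "(gram42 ** A) $ 2 $ j = A $ 2 $ j"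
  "(gram42 ** A) $ 3 $ j = A $ 3 $ j" "(gram42 ** A) $ 4 $ j = - A $ 4 $ j" "(gram42 ** A) $ 5 $ j = - A $ 0 $ j"
  by (simp_all add: matrix_matrix_mult_def sum_6 gram42_def ip42_def axis_def)

lemma transpose_gram42: "transpose gram42 = gram42"
  by (simp add: transpose_def gram42_def vec_eq_iff ip42_def algebra_simps)

lemma gram42_involution: "gram42 ** gram42 = mat 1"
  unfolding vec_eq_iff
  by (simp only: forall_6 gram42_mult) (simp add: mat_def gram42_def ip42_def axis_def)

lemma O42_iff: "A \<in> O42 \<longleftrightarrow> transpose A ** gram42 ** A = gram42"
proof -
  have "ip42 (A *v x) (A *v y) = x \<bullet> ((transpose A ** gram42 ** A) *v y)" for x y
    unfolding ip42_gram matrix_vector_mul_assoc[symmetric]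
    by (metis dot_lmul_matrix transpose_transpose vector_transpose_matrix)
  then have "A \<in> O42 \<longleftrightarrow> (\<forall>y x. x \<bullet> ((transpose A ** gram42 ** A) *v y) = x \<bullet> (gram42 *v y))"
    unfolding O42_def by (auto simp: ip42_gram)
  then show ?thesis by (simp only: vector_eq_ldot matrix_eq)
qed

text \<open>As \<open>gram42\<close> is its own inverse, the inverse of \<open>A\<close> is linear
  in the entries of \<open>A\<close>; smoothness of the inverse along a smooth map follows from this
  formula.\<close>

lemma O42_left_inverse: "A \<in> O42 \<Longrightarrow> (gram42 ** transpose A ** gram42) ** A = mat 1"
  by (metis O42_iff gram42_involution matrix_mul_assoc)

lemma O42_mult: "A \<in> O42 \<Longrightarrow> B \<in> O42 \<Longrightarrow> A ** B \<in> O42"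
  by (simp add: O42_def matrix_vector_mul_assoc[symmetric])

lemma G42_subset_O42: "G42 \<subseteq> O42"
  unfolding G42_def by (rule connected_component_subset)

lemma bounded_linear_transpose: "bounded_linear (transpose :: real^'n^'m \<Rightarrow> real^'m^'n)"
  by (simp add: linear_conv_bounded_linear[symmetric]) (auto intro!: linearI simp: transpose_def vec_eq_iff)

definition so42 :: "(real^6^6) set" where
  "so42 = {a. transpose a ** gram42 + gram42 ** a = 0}"

text \<open>On the Lie algebra \<open>gram42 ** a\<close> is skew-symmetric. Its 21 scalar equations
  are solved so that the remaining 15 entries are those occurring in the differential
  system.\<close>

lemma so42_entries:
  assumes "a \<in> so42"
  shows "a$0$5 = 0" "a$5$0 = 0" "a$1$1 = 0" "a$2$2 = 0" "a$3$3 = 0" "a$4$4 = 0" "a$5$5 = - a$0$0"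
    "a$5$1 = a$1$0" "a$5$2 = a$2$0" "a$5$3 = a$3$0" "a$5$4 = - a$4$0"
    "a$1$5 = a$0$1" "a$2$5 = a$0$2" "a$3$5 = a$0$3" "a$4$5 = - a$0$4"
    "a$1$2 = - a$2$1" "a$1$3 = - a$3$1" "a$2$3 = - a$3$2" "a$1$4 = a$4$1" "a$2$4 = a$4$2" "a$3$4 = a$4$3"
proof -
  have "transpose a ** gram42 = transpose (gram42 ** a)"
    by (simp add: matrix_transpose_mul transpose_gram42)
  then have eq: "(gram42 ** a) $ j $ i + (gram42 ** a) $ i $ j = 0" for i j
    using assms unfolding so42_def vec_eq_iff by (simp add: transpose_def)
  show "a$0$5 = 0" "a$5$0 = 0" "a$1$1 = 0" "a$2$2 = 0" "a$3$3 = 0" "a$4$4 = 0" "a$5$5 = - a$0$0"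
    "a$5$1 = a$1$0" "a$5$2 = a$2$0" "a$5$3 = a$3$0" "a$5$4 = - a$4$0"
    "a$1$5 = a$0$1" "a$2$5 = a$0$2" "a$3$5 = a$0$3" "a$4$5 = - a$0$4"
    "a$1$2 = - a$2$1" "a$1$3 = - a$3$1" "a$2$3 = - a$3$2" "a$1$4 = a$4$1" "a$2$4 = a$4$2" "a$3$4 = a$4$3"
    using eq[of 5 5] eq[of 0 0] eq[of 1 1] eq[of 2 2] eq[of 3 3] eq[of 4 4] eq[of 0 5]
      eq[of 0 1] eq[of 0 2] eq[of 0 3] eq[of 0 4] eq[of 5 1] eq[of 5 2] eq[of 5 3] eq[of 5 4]
      eq[of 1 2] eq[of 1 3] eq[of 2 3] eq[of 1 4] eq[of 2 4] eq[of 3 4]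
    by (simp_all add: gram42_mult)
qed

definition mc :: "('a::euclidean_space \<Rightarrow> real^6^6) \<Rightarrow> 'a \<Rightarrow> 'a \<Rightarrow> real^6^6" where
  "mc A w u = matrix_inv (A w) ** frechet_derivative A (at w) u"

lemma mc_form_mc: "mc_form A J K w v = mc A w (v 0) $ J $ K"
  by (simp add: mc_form_def mc_def)

lemma linear_entry: "bounded_linear (\<lambda>X :: real^'n^'m. X $ j $ k)"
  using bounded_linear_compose[OF bounded_linear_vec_nth bounded_linear_vec_nth] .

text \<open>Instantiated with both components of a section; values in \<open>O42\<close> provide the
  explicit inverse and the Lie algebra identities.\<close>

locale group_map =
  fixes W :: "'a::euclidean_space set" and A :: "'a \<Rightarrow> real^6^6"
  assumes open_W: "open W" and smooth_A: "smooth_on W A" and O42: "\<And>w. w \<in> W \<Longrightarrow> A w \<in> O42"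
begin

definition M :: "'a \<Rightarrow> real^6^6" where
  "M w = gram42 ** transpose (A w) ** gram42"

lemma M_left_inverse: "w \<in> W \<Longrightarrow> M w ** A w = mat 1"
  unfolding M_def by (intro O42_left_inverse O42)

lemma mc_M: "w \<in> W \<Longrightarrow> mc A w u = M w ** frechet_derivative A (at w) u"
  by (simp add: mc_def matrix_inv_eqI[OF M_left_inverse])

lemma smooth_M: "smooth_on W M"
proof -
  have "bounded_linear (\<lambda>X. gram42 ** transpose X ** gram42)"
    by (intro bounded_linear_compose[OF bounded_bilinear.bounded_linear_left[OF bounded_bilinear_matrix_mult]]
        bounded_linear_compose[OF bounded_bilinear.bounded_linear_right[OF bounded_bilinear_matrix_mult]]
        bounded_linear_transpose)
  then show ?thesis unfolding M_def by (rule smooth_on_bounded_linear[OF open_W _ smooth_A])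
qed

lemma differentiable_A: "w \<in> W \<Longrightarrow> (A has_derivative frechet_derivative A (at w)) (at w)"
  using smooth_on_differentiable[OF smooth_A] by (simp add: frechet_derivative_works[symmetric])

lemma linear_mc: "w \<in> W \<Longrightarrow> linear (mc A w)"
  unfolding mc_def
  by (rule linear_compose[OF has_derivative_linear[OF differentiable_A]
        bounded_linear.linear[OF bounded_bilinear.bounded_linear_right[OF bounded_bilinear_matrix_mult]],
        unfolded o_def])

lemma smooth_mc: "smooth_on W (\<lambda>w. M w ** frechet_derivative A (at w) u)"
  by (rule smooth_on_bounded_bilinear[OF open_W bounded_bilinear_matrix_mult smooth_M
        smooth_on_frechet_derivative[OF smooth_A]])

lemma smooth_form_mc: "smooth_form W 1 (mc_form A J K)"
  unfolding smooth_form_def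
proof (intro conjI ballI allI)
  fix w assume "w \<in> W"
  then show "alternating_form 1 (mc_form A J K w)"
    by (intro alternating_form_1I[of "\<lambda>u. mc A w u $ J $ K"] mc_form_mc
        linear_compose[OF linear_mc bounded_linear.linear[OF linear_entry], unfolded o_def])
next
  fix v :: "nat \<Rightarrow> 'a"
  have "smooth_on W (\<lambda>w. (M w ** frechet_derivative A (at w) (v 0)) $ J $ K)"
    by (rule smooth_on_bounded_linear[OF open_W linear_entry smooth_mc])
  then show "smooth_on W (\<lambda>w. mc_form A J K w v)"
    by (rule smooth_on_cong[OF open_W, rotated]) (simp add: mc_form_mc mc_M)
qed

lemma derivative_mc: "w \<in> W \<Longrightarrow> frechet_derivative A (at w) u = A w ** mc A w u"
proof -
  assume w: "w \<in> W"
  have "A w ** M w = mat 1" using M_left_inverse[OF w] by (simp add: matrix_left_right_inverse)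
  then show ?thesis by (simp add: mc_M[OF w] matrix_mul_assoc)
qed

text \<open>The derivative of the constant \<open>transpose (A w) ** gram42 ** A w\<close> vanishes;
  writing dA as \<open>A\<close> times its Maurer-Cartan value turns this into the Lie algebra
  condition.\<close>

lemma mc_so42: "w \<in> W \<Longrightarrow> mc A w u \<in> so42"
proof -
  assume w: "w \<in> W"
  let ?A' = "frechet_derivative A (at w)"
  note bb = bounded_bilinear_matrix_mult
  have "((\<lambda>w. transpose (A w) ** gram42) has_derivative (\<lambda>u. transpose (?A' u) ** gram42)) (at w)"
    by (rule bounded_linear.has_derivative[OF bounded_bilinear.bounded_linear_left[OF bb]
          bounded_linear.has_derivative[OF bounded_linear_transpose differentiable_A[OF w]]])
  then have "((\<lambda>w. transpose (A w) ** gram42 ** A w) has_derivative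
      (\<lambda>u. (transpose (A w) ** gram42) ** ?A' u + (transpose (?A' u) ** gram42) ** A w)) (at w)"
    by (rule bounded_bilinear.FDERIV[OF bb _ differentiable_A[OF w]])
  moreover have "((\<lambda>w. transpose (A w) ** gram42 ** A w) has_derivative (\<lambda>u. 0)) (at w)"
    by (rule has_derivative_transform_within_open[OF has_derivative_const open_W w, of gram42])
      (metis O42 O42_iff)
  ultimately have "(\<lambda>u. (transpose (A w) ** gram42) ** ?A' u + (transpose (?A' u) ** gram42) ** A w) = (\<lambda>u. 0)"
    by (rule has_derivative_unique)
  then have "(transpose (A w) ** gram42) ** ?A' u + (transpose (?A' u) ** gram42) ** A w = 0" by (rule fun_cong)
  then have "(transpose (A w) ** gram42 ** A w) ** mc A w u + transpose (mc A w u) ** (transpose (A w) ** gram42 ** A w) = 0"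
    by (simp add: derivative_mc[OF w] matrix_transpose_mul matrix_mul_assoc)
  moreover have "transpose (A w) ** gram42 ** A w = gram42" using O42[OF w] by (simp add: O42_iff)
  ultimately show ?thesis by (simp add: so42_def add.commute)
qed

text \<open>The equation d\<omega> = - \<omega> \<and> \<omega>, entry by entry and evaluated on two
  vectors.\<close>

lemma ext_deriv_mc:
  assumes w: "w \<in> W"
  shows "ext_deriv 1 (mc_form A J K) w e = - (mc A w (e 0) ** mc A w (e 1) - mc A w (e 1) ** mc A w (e 0)) $ J $ K"
proof -
  have fd: "frechet_derivative (\<lambda>y. mc_form A J K y (\<lambda>_. v)) (at w) u
      = frechet_derivative (\<lambda>y. M y ** frechet_derivative A (at y) v) (at w) u $ J $ K" for u v
  proof -
    have d: "(\<lambda>y. M y ** frechet_derivative A (at y) v) differentiable (at w)"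
      using smooth_on_differentiable[OF smooth_mc w] .
    have "frechet_derivative (\<lambda>y. mc_form A J K y (\<lambda>_. v)) (at w)
        = frechet_derivative (\<lambda>y. (M y ** frechet_derivative A (at y) v) $ J $ K) (at w)"
    proof (rule frechet_derivative_transform_within_open[OF _ open_W w])
      show "(\<lambda>y. mc_form A J K y (\<lambda>_. v)) differentiable (at w)"
        by (rule smooth_form_1_differentiable[OF smooth_form_mc w])
    qed (simp add: mc_form_mc mc_M)
    then show ?thesis using frechet_derivative_bounded_linear[OF linear_entry d] by simp
  qed
  have "ext_deriv 1 (mc_form A J K) w e
      = (frechet_derivative (\<lambda>y. M y ** frechet_derivative A (at y) (e 1)) (at w) (e 0)
         - frechet_derivative (\<lambda>y. M y ** frechet_derivative A (at y) (e 0)) (at w) (e 1)) $ J $ K"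
    unfolding ext_deriv_1_const[OF open_W smooth_form_mc w] fd by simp
  also have "\<dots> = - (mc A w (e 0) ** mc A w (e 1) - mc A w (e 1) ** mc A w (e 0)) $ J $ K"
    by (subst maurer_cartan_equation[OF open_W smooth_A smooth_M w M_left_inverse]) (simp_all add: mc_M[OF w])
  finally show ?thesis .
qed

end

text \<open>Polymorphic so that one list can be read with 1-forms, with their values on a vector,
  and with their exterior derivatives. The first eight members follow the order of
  \<open>isothermic_relations\<close>; the other fifteen are the generators.\<close>

definition coframe_list :: "(6 \<Rightarrow> 6 \<Rightarrow> 'b) \<Rightarrow> (6 \<Rightarrow> 6 \<Rightarrow> 'b) \<Rightarrow> 'b::minus list" where
  "coframe_list \<alpha> \<beta> =
     [\<alpha> 1 0, \<alpha> 2 0, \<alpha> 3 1, \<alpha> 3 2, \<alpha> 4 1, \<alpha> 4 2, \<alpha> 0 1 - \<beta> 0 1, \<alpha> 0 2 - \<beta> 0 2,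
      \<alpha> 1 0 - \<beta> 1 0, \<alpha> 2 0 - \<beta> 2 0, \<alpha> 3 0, \<alpha> 4 0, \<beta> 3 0, \<beta> 4 0,
      \<alpha> 0 0 - \<beta> 0 0, \<alpha> 2 1 - \<beta> 2 1, \<alpha> 4 3 - \<beta> 4 3,
      \<alpha> 3 1 - \<beta> 3 1, \<alpha> 3 2 - \<beta> 3 2, \<alpha> 4 1 - \<beta> 4 1, \<alpha> 4 2 - \<beta> 4 2,
      \<alpha> 0 3 - \<beta> 0 3, \<alpha> 0 4 - \<beta> 0 4]"

lemma atLeastLessThan_8_23: "{8..<23::nat} = {8, 9, 10, 11, 12, 13, 14, 15, 16, 17, 18, 19, 20, 21, 22}"
  by (simp add: atLeastLessThan_upt)

lemma I3_gens_coframe: "I3_gens \<alpha> \<beta> = (\<lambda>j. coframe_list \<alpha> \<beta> ! j) ` {8..<23}"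
  unfolding atLeastLessThan_8_23 I3_gens_def coframe_list_def by auto

text \<open>Modulo the generators the derivatives of \<alpha>^i_0 - \<beta>^i_0, \<alpha>^4_3 -
  \<beta>^4_3 and \<alpha>^a_i - \<beta>^a_i vanish, while \<alpha>^a_0 and \<beta>^a_0 give the
  same relation h^a \<and> \<phi> = 0. The forms \<alpha>^0_0 - \<beta>^0_0 and \<alpha>^2_1 -
  \<beta>^2_1 give the relations of \<eta> with \<phi> and J\<phi>, and \<alpha>^0_a - \<beta>^0_a
  gives \<eta> \<and> h^a = 0.\<close>

lemma isothermic_torsion:
  assumes so: "a \<in> so42" "a' \<in> so42" "b \<in> so42" "b' \<in> so42"
    and gens: "\<forall>j\<in>{8..<23}. coframe_list (\<lambda>J K. a$J$K) (\<lambda>J K. b$J$K) ! j = 0"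
      "\<forall>j\<in>{8..<23}. coframe_list (\<lambda>J K. a'$J$K) (\<lambda>J K. b'$J$K) ! j = 0"
  shows "(\<forall>j\<in>{8..<23}. coframe_list (\<lambda>J K. - (a ** a' - a' ** a)$J$K) (\<lambda>J K. - (b ** b' - b' ** b)$J$K) ! j = 0)
    \<longleftrightarrow> isothermic_relations ((!) (coframe_list (\<lambda>J K. a$J$K) (\<lambda>J K. b$J$K)))
          ((!) (coframe_list (\<lambda>J K. a'$J$K) (\<lambda>J K. b'$J$K)))"
proof -
  have g: "b$1$0 = a$1$0" "b$2$0 = a$2$0" "a$3$0 = 0" "a$4$0 = 0" "b$3$0 = 0" "b$4$0 = 0" "b$0$0 = a$0$0"
    "b$2$1 = a$2$1" "b$4$3 = a$4$3" "b$3$1 = a$3$1" "b$3$2 = a$3$2" "b$4$1 = a$4$1" "b$4$2 = a$4$2"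
    "b$0$3 = a$0$3" "b$0$4 = a$0$4"
    using gens(1) unfolding atLeastLessThan_8_23 coframe_list_def by simp_all
  have g': "b'$1$0 = a'$1$0" "b'$2$0 = a'$2$0" "a'$3$0 = 0" "a'$4$0 = 0" "b'$3$0 = 0" "b'$4$0 = 0" "b'$0$0 = a'$0$0"
    "b'$2$1 = a'$2$1" "b'$4$3 = a'$4$3" "b'$3$1 = a'$3$1" "b'$3$2 = a'$3$2" "b'$4$1 = a'$4$1" "b'$4$2 = a'$4$2"
    "b'$0$3 = a'$0$3" "b'$0$4 = a'$0$4"
    using gens(2) unfolding atLeastLessThan_8_23 coframe_list_def by simp_all
  note rel = so42_entries[OF so(1)] so42_entries[OF so(2)] so42_entries[OF so(3)] so42_entries[OF so(4)] g g'
  show ?thesis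
    unfolding atLeastLessThan_8_23 coframe_list_def isothermic_relations_def
    by (simp add: matrix_matrix_mult_def sum_6 rel) (auto simp: algebra_simps)
qed

section \<open>The coframe of the configuration space\<close>

definition vec6 :: "'a \<Rightarrow> 'a \<Rightarrow> 'a \<Rightarrow> 'a \<Rightarrow> 'a \<Rightarrow> 'a \<Rightarrow> 'a^6" where
  "vec6 a b c d e f = (\<chi> i. if i = 0 then a else if i = 1 then b else if i = 2 then c
     else if i = 3 then d else if i = 4 then e else f)"

lemma vec6_nth [simp]:
  "vec6 a b c d e f $ 0 = a" "vec6 a b c d e f $ 1 = b" "vec6 a b c d e f $ 2 = c"
  "vec6 a b c d e f $ 3 = d" "vec6 a b c d e f $ 4 = e" "vec6 a b c d e f $ 5 = f"
  by (simp_all add: vec6_def)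

lemma has_derivative_matrix_curve:
  fixes h :: "real \<Rightarrow> real^'n^'m"
  assumes "\<forall>i j. ((\<lambda>t. h t $ i $ j) has_real_derivative a $ i $ j) (at t0)"
  shows "(h has_derivative (\<lambda>t. t *\<^sub>R a)) (at t0)"
proof -
  have "((\<lambda>t. h t $ i $ j) has_derivative (\<lambda>t. t * a $ i $ j)) (at t0)" for i j
    using assms by (simp add: has_field_derivative_def mult.commute[of _ "a $ i $ j"])
  then show ?thesis
    by (subst has_derivative_componentwise_within) (auto simp: Basis_vec_def inner_axis)
qed

lemma continuous_on_matrix_curve:
  fixes h :: "real \<Rightarrow> real^'n^'m"
  assumes "\<forall>i j. continuous_on S (\<lambda>t. h t $ i $ j)"
  shows "continuous_on S h"
proof -
  have "continuous_on S (\<lambda>t. \<chi> i. \<chi> j. h t $ i $ j)"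
    using assms by (intro continuous_on_vec_lambda) auto
  then show ?thesis by simp
qed

definition preserves_012 :: "real^6^6 \<Rightarrow> bool" where
  "preserves_012 h \<longleftrightarrow> (\<forall>i\<in>{3, 4, 5}. \<forall>j\<in>{0, 1, 2}. h $ i $ j = 0)"

text \<open>A curve in the stabiliser of the base plane, recorded with its velocity at the identity:
  it certifies that \<open>a\<close> is a fibre direction.\<close>

definition isotropy_curve :: "(real \<Rightarrow> real^6^6) \<Rightarrow> real^6^6 \<Rightarrow> bool" where
  "isotropy_curve h a \<longleftrightarrow> h 0 = mat 1 \<and> continuous_on UNIV h \<and> (\<forall>t. h t \<in> O42 \<and> preserves_012 (h t)) \<and>
     (h has_derivative (\<lambda>t. t *\<^sub>R a)) (at 0)"

text \<open>\<open>h\<close> maps the span of the first three basis vectors into itself and is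
  injective, so by dimension it maps it onto itself.\<close>

lemma span_columns_012:
  assumes A: "A \<in> O42" and h: "h \<in> O42" "preserves_012 h"
  shows "span {column 0 (A ** h), column 1 (A ** h), column 2 (A ** h)} = span {column 0 A, column 1 A, column 2 A}"
proof -
  let ?E = "{axis 0 1, axis 1 1, axis 2 (1::real)} :: (real^6) set"
  have inj: "inj ((*v) B)" if "B \<in> O42" for B
    using O42_left_inverse[OF that] by (metis inj_matrix_vector_mult invertible_left_inverse)
  have cols: "span {column 0 B, column 1 B, column 2 B} = ((*v) B) ` span ?E" for B :: "real^6^6"
    using span_linear_image[of "(*v) B" ?E] by (simp add: matrix_vector_mult_basis)
  have "((*v) h) ` ?E \<subseteq> span ?E"
  proof -
    have "h *v axis j 1 \<in> span ?E" if j: "j \<in> {0, 1, 2}" for j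
    proof -
      have "h *v axis j 1 = h $ 0 $ j *\<^sub>R axis 0 1 + h $ 1 $ j *\<^sub>R axis 1 1 + h $ 2 $ j *\<^sub>R axis 2 1"
        unfolding matrix_vector_mult_basis vec_eq_iff forall_6
        using h(2) j by (auto simp: preserves_012_def column_def axis_def)
      then show ?thesis by (simp add: span_add span_scale span_base)
    qed
    then show ?thesis by auto
  qed
  then have sub: "((*v) h) ` span ?E \<subseteq> span ?E"
    by (metis matrix_vector_mul_linear span_linear_image span_minimal subspace_span)
  have "((*v) h) ` span ?E = span ?E"
  proof (rule subspace_dim_equal[OF _ _ sub])
    show "subspace ((*v) h ` span ?E)" by (intro linear_subspace_image) auto
    show "dim (span ?E) \<le> dim ((*v) h ` span ?E)"
      using inj[OF h(1)] by (subst dim_image_eq) (auto intro: inj_on_subset)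
  qed simp
  then have "((*v) (A ** h)) ` span ?E = ((*v) A) ` span ?E"
    by (metis (no_types, lifting) image_comp image_cong matrix_vector_mul_assoc o_apply)
  then show ?thesis unfolding cols .
qed

text \<open>The same \<open>h\<close> acts on both factors and cancels in (B h) (A h)^(-1), so the
  diagonal isotropy action preserves the fibres.\<close>

lemma proj_D_isotropy:
  assumes A: "A \<in> O42" and B: "B \<in> O42" and h: "h \<in> O42" "preserves_012 h"
  shows "proj_D (A ** h, B ** h) = proj_D (A, B)"
proof -
  let ?i = "\<lambda>A. gram42 ** transpose A ** gram42"
  have hi: "h ** ?i h = mat 1" using O42_left_inverse[OF h(1)] by (simp add: matrix_left_right_inverse)
  have inv: "matrix_inv C = ?i C" if "C \<in> O42" for C
    using O42_left_inverse[OF that] by (rule matrix_inv_eqI)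
  have "?i (A ** h) = (gram42 ** transpose h) ** (gram42 ** gram42) ** (transpose A ** gram42)"
    by (simp add: gram42_involution matrix_transpose_mul matrix_mul_assoc)
  then have "?i (A ** h) = ?i h ** ?i A" by (simp only: matrix_mul_assoc)
  then have "(B ** h) ** ?i (A ** h) = B ** (h ** ?i h) ** ?i A" by (simp only: matrix_mul_assoc)
  then have "(B ** h) ** matrix_inv (A ** h) = B ** matrix_inv A"
    using inv[OF O42_mult[OF A h(1)]] inv[OF A] hi by simp
  then show ?thesis
    unfolding proj_D_def using span_columns_012[OF A h] span_columns_012[OF B h] by simp
qed

text \<open>The curve starts at \<open>A\<close> and stays in \<open>O42\<close>, so it cannot leave
  the connected component of \<open>A\<close>.\<close>

lemma G42_isotropy:
  assumes A: "A \<in> G42" and h: "isotropy_curve h a"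
  shows "A ** h t \<in> G42"
proof -
  have "continuous_on UNIV (\<lambda>t. A ** h t)"
    using h by (intro bounded_linear.continuous_on[OF bounded_bilinear.bounded_linear_right[OF bounded_bilinear_matrix_mult]])
      (auto simp: isotropy_curve_def)
  then have "connected (range (\<lambda>t. A ** h t))"
    by (rule connected_continuous_image) simp
  moreover have "A \<in> range (\<lambda>t. A ** h t)"
    using h by (intro range_eqI[of _ _ 0]) (simp add: isotropy_curve_def)
  moreover have "range (\<lambda>t. A ** h t) \<subseteq> O42"
    using h A G42_subset_O42 O42_mult by (auto simp: isotropy_curve_def)
  ultimately have "range (\<lambda>t. A ** h t) \<subseteq> connected_component_set O42 A"
    by (intro connected_component_maximal)
  then show ?thesis
    using connected_component_eq[of A O42 "mat 1"] A unfolding G42_def by auto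
qed

text \<open>\<open>X\<close> is defined on ambient matrices, but the curve stays in the group and in
  one fibre, where \<open>X\<close> is the chart after the projection; hence \<open>X\<close> is
  constant along it near 0.\<close>

lemma derivative_along_isotropy:
  fixes X :: "(real^6^6) \<times> (real^6^6) \<Rightarrow> 'b::real_normed_vector"
  assumes N: "open N" "(A, B) \<in> N" and AB: "A \<in> G42" "B \<in> G42" "proj_D (A, B) \<in> U"
    and X: "\<And>g. g \<in> N \<Longrightarrow> g \<in> G42 \<times> G42 \<Longrightarrow> proj_D g \<in> U \<Longrightarrow> X g = x (proj_D g)"
    and D: "(X has_derivative DX) (at (A, B))"
    and h: "isotropy_curve h a"
  shows "DX (A ** a, B ** a) = 0"
proof -
  let ?c = "\<lambda>t. (A ** h t, B ** h t)"
  note bl = bounded_bilinear.bounded_linear_right[OF bounded_bilinear_matrix_mult]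
  have h0: "h 0 = mat 1" and hc: "continuous_on UNIV h" and hO: "\<And>t. h t \<in> O42" "\<And>t. preserves_012 (h t)"
    and hd: "(h has_derivative (\<lambda>t. t *\<^sub>R a)) (at 0)"
    using h by (auto simp: isotropy_curve_def)
  have pr: "proj_D (?c t) = proj_D (A, B)" for t
    using AB G42_subset_O42 hO by (intro proj_D_isotropy) auto
  have "(?c has_derivative (\<lambda>t. (A ** (t *\<^sub>R a), B ** (t *\<^sub>R a)))) (at 0)"
    by (intro has_derivative_Pair bounded_linear.has_derivative[OF bl] hd)
  then have "((\<lambda>t. X (?c t)) has_derivative (\<lambda>t. DX (A ** (t *\<^sub>R a), B ** (t *\<^sub>R a)))) (at 0)"
    by (rule has_derivative_compose) (simp add: h0 D)
  moreover have "((\<lambda>t. X (?c t)) has_derivative (\<lambda>t. 0)) (at 0)"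
  proof (rule has_derivative_transform_within_open[OF has_derivative_const])
    have "continuous_on UNIV ?c"
      by (intro continuous_on_Pair bounded_linear.continuous_on[OF bl] hc)
    then show "open (?c -` N)" using N(1) by (intro open_vimage)
    show "0 \<in> ?c -` N" using N(2) by (simp add: h0)
    show "x (proj_D (A, B)) = X (?c t)" if "t \<in> ?c -` N" for t
      using X[of "?c t"] that G42_isotropy[OF _ h] AB pr[of t] by simp
  qed
  ultimately have "(\<lambda>t. DX (A ** (t *\<^sub>R a), B ** (t *\<^sub>R a))) = (\<lambda>t. 0)"
    by (rule has_derivative_unique)
  from fun_cong[OF this, of 1] show ?thesis by simp
qed

section \<open>Curves in the isotropy group and their velocities\<close>

definition scaling :: "real \<Rightarrow> real \<Rightarrow> real^6^6" where
  "scaling p q = vec6 (vec6 p 0 0 0 0 0) (vec6 0 1 0 0 0 0) (vec6 0 0 1 0 0 0)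
     (vec6 0 0 0 1 0 0) (vec6 0 0 0 0 1 0) (vec6 0 0 0 0 0 q)"

definition rotation12 :: "real \<Rightarrow> real \<Rightarrow> real^6^6" where
  "rotation12 c s = vec6 (vec6 1 0 0 0 0 0) (vec6 0 c (- s) 0 0 0) (vec6 0 s c 0 0 0)
     (vec6 0 0 0 1 0 0) (vec6 0 0 0 0 1 0) (vec6 0 0 0 0 0 1)"

definition boost34 :: "real \<Rightarrow> real \<Rightarrow> real^6^6" where
  "boost34 c s = vec6 (vec6 1 0 0 0 0 0) (vec6 0 1 0 0 0 0) (vec6 0 0 1 0 0 0)
     (vec6 0 0 0 c s 0) (vec6 0 0 0 s c 0) (vec6 0 0 0 0 0 1)"

text \<open>The factor of the isotropy group with trivial diagonal blocks; the sign of
  \<open>s\<close> in row 0 and the quadratic corner entry are forced by invariance of the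
  form.\<close>

definition translation :: "real \<Rightarrow> real \<Rightarrow> real \<Rightarrow> real \<Rightarrow> real^6^6" where
  "translation p q r s = vec6 (vec6 1 p q r (- s) ((p * p + q * q + r * r - s * s) / 2)) (vec6 0 1 0 0 0 p)
     (vec6 0 0 1 0 0 q) (vec6 0 0 0 1 0 r) (vec6 0 0 0 0 1 s) (vec6 0 0 0 0 0 1)"

lemma isotropy_matrices_O42:
  "p * q = 1 \<Longrightarrow> scaling p q \<in> O42"
  "c * c + s * s = 1 \<Longrightarrow> rotation12 c s \<in> O42"
  "c * c - s * s = 1 \<Longrightarrow> boost34 c s \<in> O42"
  "translation p q r s \<in> O42"
proof -
  show "scaling p q \<in> O42" if "p * q = 1"
    using that by (simp add: O42_def ip42_def matrix_vector_mult_def sum_6 scaling_def) algebra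
  show "rotation12 c s \<in> O42" if "c * c + s * s = 1"
    using that by (simp add: O42_def ip42_def matrix_vector_mult_def sum_6 rotation12_def) algebra
  show "boost34 c s \<in> O42" if "c * c - s * s = 1"
    using that by (simp add: O42_def ip42_def matrix_vector_mult_def sum_6 boost34_def) algebra
  show "translation p q r s \<in> O42"
    by (simp add: O42_def ip42_def matrix_vector_mult_def sum_6 translation_def field_simps)
qed

lemma isotropy_matrices_preserve:
  "preserves_012 (scaling p q)" "preserves_012 (rotation12 c s)" "preserves_012 (boost34 c s)"
  "preserves_012 (translation p q r s)"
  by (simp_all add: preserves_012_def scaling_def rotation12_def boost34_def translation_def)

lemma isotropy_curveI:
  assumes "h 0 = mat 1" "\<And>t. h t \<in> O42" "\<And>t. preserves_012 (h t)"
    and "\<forall>i j. continuous_on UNIV (\<lambda>t. h t $ i $ j)"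
    and "\<forall>i j. ((\<lambda>t. h t $ i $ j) has_real_derivative a $ i $ j) (at 0)"
  shows "isotropy_curve h a"
  unfolding isotropy_curve_def
  using assms continuous_on_matrix_curve[OF assms(4)] has_derivative_matrix_curve[OF assms(5)] by blast

lemma isotropy_curve_scaling:
  "isotropy_curve (\<lambda>t. scaling (exp t) (exp (- t)))
     (vec6 (vec6 1 0 0 0 0 0) (vec6 0 0 0 0 0 0) (vec6 0 0 0 0 0 0) (vec6 0 0 0 0 0 0) (vec6 0 0 0 0 0 0) (vec6 0 0 0 0 0 (-1)))"
proof (rule isotropy_curveI)
  show "scaling (exp t) (exp (- t)) \<in> O42" for t
    by (rule isotropy_matrices_O42) (rule exp_minus_inverse)
  show "preserves_012 (scaling (exp t) (exp (- t)))" for t by (rule isotropy_matrices_preserve)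
qed (simp_all only: forall_6 vec_eq_iff scaling_def vec6_nth,
     auto simp: mat_def intro!: continuous_intros derivative_eq_intros)

lemma isotropy_curve_rotation12:
  "isotropy_curve (\<lambda>t. rotation12 (cos t) (sin t))
     (vec6 (vec6 0 0 0 0 0 0) (vec6 0 0 (-1) 0 0 0) (vec6 0 1 0 0 0 0) (vec6 0 0 0 0 0 0) (vec6 0 0 0 0 0 0) (vec6 0 0 0 0 0 0))"
proof (rule isotropy_curveI)
  show "rotation12 (cos t) (sin t) \<in> O42" for t
    by (rule isotropy_matrices_O42) (simp add: power2_eq_square[symmetric])
  show "preserves_012 (rotation12 (cos t) (sin t))" for t by (rule isotropy_matrices_preserve)
qed (simp_all only: forall_6 vec_eq_iff rotation12_def vec6_nth,
     auto simp: mat_def intro!: continuous_intros derivative_eq_intros)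

lemma isotropy_curve_boost34:
  "isotropy_curve (\<lambda>t. boost34 (cosh t) (sinh t))
     (vec6 (vec6 0 0 0 0 0 0) (vec6 0 0 0 0 0 0) (vec6 0 0 0 0 0 0) (vec6 0 0 0 0 1 0) (vec6 0 0 0 1 0 0) (vec6 0 0 0 0 0 0))"
proof (rule isotropy_curveI)
  show "boost34 (cosh t) (sinh t) \<in> O42" for t
    by (rule isotropy_matrices_O42) (metis hyperbolic_pythagoras power2_eq_square)
  show "preserves_012 (boost34 (cosh t) (sinh t))" for t by (rule isotropy_matrices_preserve)
qed (simp_all only: forall_6 vec_eq_iff boost34_def vec6_nth,
     auto simp: mat_def intro!: continuous_intros derivative_eq_intros)

text \<open>The corner entry is quadratic in \<open>t\<close> and so contributes nothing to the
  velocity at 0.\<close>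

lemma isotropy_curve_translation:
  "isotropy_curve (\<lambda>t. translation (t * p) (t * q) (t * r) (t * s))
     (vec6 (vec6 0 p q r (- s) 0) (vec6 0 0 0 0 0 p) (vec6 0 0 0 0 0 q) (vec6 0 0 0 0 0 r) (vec6 0 0 0 0 0 s) (vec6 0 0 0 0 0 0))"
proof (rule isotropy_curveI)
  show "translation (t * p) (t * q) (t * r) (t * s) \<in> O42" for t
    by (rule isotropy_matrices_O42)
  show "preserves_012 (translation (t * p) (t * q) (t * r) (t * s))" for t
    by (rule isotropy_matrices_preserve)
qed (simp_all only: forall_6 vec_eq_iff translation_def vec6_nth,
     auto simp: mat_def intro!: continuous_intros derivative_eq_intros)

text \<open>The eight vanishing entries are the tangent directions of the space of 3-planes. What is
  left is the 7-dimensional isotropy algebra, spanned by velocities of the explicit curves, and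
  linearity does the rest.\<close>

lemma isotropy_algebra_kernel:
  fixes a :: "real^6^6"
  assumes "linear L" and L: "\<And>h a. isotropy_curve h a \<Longrightarrow> L a = 0"
    and a: "a \<in> so42" "a$1$0 = 0" "a$2$0 = 0" "a$3$0 = 0" "a$4$0 = 0"
      "a$3$1 = 0" "a$3$2 = 0" "a$4$1 = 0" "a$4$2 = 0"
  shows "L a = 0"
proof -
  define T1 T2 T3 :: "real^6^6" where
    "T1 = vec6 (vec6 1 0 0 0 0 0) (vec6 0 0 0 0 0 0) (vec6 0 0 0 0 0 0) (vec6 0 0 0 0 0 0) (vec6 0 0 0 0 0 0) (vec6 0 0 0 0 0 (-1))"
    and "T2 = vec6 (vec6 0 0 0 0 0 0) (vec6 0 0 (-1) 0 0 0) (vec6 0 1 0 0 0 0) (vec6 0 0 0 0 0 0) (vec6 0 0 0 0 0 0) (vec6 0 0 0 0 0 0)"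
    and "T3 = vec6 (vec6 0 0 0 0 0 0) (vec6 0 0 0 0 0 0) (vec6 0 0 0 0 0 0) (vec6 0 0 0 0 1 0) (vec6 0 0 0 1 0 0) (vec6 0 0 0 0 0 0)"
  define T4 :: "real \<Rightarrow> real \<Rightarrow> real \<Rightarrow> real \<Rightarrow> real^6^6" where
    "T4 p q r s = vec6 (vec6 0 p q r (- s) 0) (vec6 0 0 0 0 0 p) (vec6 0 0 0 0 0 q) (vec6 0 0 0 0 0 r) (vec6 0 0 0 0 0 s) (vec6 0 0 0 0 0 0)"
    for p q r s
  have "L T1 = 0" "L T2 = 0" "L T3 = 0" "L (T4 p q r s) = 0" for p q r s
    unfolding T1_def T2_def T3_def T4_def
    by (rule L isotropy_curve_scaling isotropy_curve_rotation12 isotropy_curve_boost34 isotropy_curve_translation)+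
  \<comment> \<open>The last argument is negated because the velocity of a translation has
    \<open>- s\<close> in row 0.\<close>
  then have "L (a$0$0 *\<^sub>R T1 + a$2$1 *\<^sub>R T2 + a$4$3 *\<^sub>R T3 + T4 (a$0$1) (a$0$2) (a$0$3) (- a$0$4)) = 0"
    by (simp add: linear_add[OF \<open>linear L\<close>] linear_scale[OF \<open>linear L\<close>])
  moreover have "a$0$0 *\<^sub>R T1 + a$2$1 *\<^sub>R T2 + a$4$3 *\<^sub>R T3 + T4 (a$0$1) (a$0$2) (a$0$3) (- a$0$4) = a"
    unfolding vec_eq_iff forall_6 T1_def T2_def T3_def T4_def by (simp add: so42_entries[OF a(1)] a(2-))
  ultimately show ?thesis by simp
qed

section \<open>Sections over a chart of the configuration space\<close>

context
  fixes U :: "config set" and x :: "config \<Rightarrow> real^23" and s :: "config \<Rightarrow> (real^6^6) \<times> (real^6^6)"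
  assumes chart: "chart_with_section U x s"
begin

abbreviation "secA \<equiv> \<lambda>w. fst (s (inv_into U x w))"
abbreviation "secB \<equiv> \<lambda>w. snd (s (inv_into U x w))"

lemma open_chart: "open (x ` U)"
  using chart by (simp add: chart_with_section_def)

lemma section_G42: "w \<in> x ` U \<Longrightarrow> secA w \<in> G42 \<and> secB w \<in> G42"
proof -
  assume "w \<in> x ` U"
  then have "inv_into U x w \<in> U" by (rule inv_into_into)
  then have "s (inv_into U x w) \<in> G42 \<times> G42" using chart by (simp add: chart_with_section_def)
  then show ?thesis by (simp add: mem_Times_iff)
qed

lemma section_proj: "w \<in> x ` U \<Longrightarrow> proj_D (secA w, secB w) = inv_into U x w"
  using chart inv_into_into[of w x U] by (simp add: chart_with_section_def)

lemma smooth_section: "smooth_on (x ` U) secA" "smooth_on (x ` U) secB"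
proof -
  have "smooth_on (x ` U) (\<lambda>w. s (inv_into U x w))" using chart by (simp add: chart_with_section_def)
  then show "smooth_on (x ` U) secA" "smooth_on (x ` U) secB"
    using smooth_on_bounded_linear[OF open_chart bounded_linear_fst]
      smooth_on_bounded_linear[OF open_chart bounded_linear_snd] by blast+
qed

lemma group_map_A: "group_map (x ` U) secA" and group_map_B: "group_map (x ` U) secB"
  using open_chart smooth_section section_G42 G42_subset_O42 by (auto intro!: group_map.intro)

text \<open>\<open>X\<close> extends the chart composed with the projection to ambient matrices. Its derivative undoes
  the derivative of the section, but kills the directions tangent to the fibre.\<close>

lemma section_transversal:
  assumes w: "w \<in> x ` U" and eq: "mc secA w u = mc secB w u"
    and a: "mc secA w u $1$0 = 0" "mc secA w u $2$0 = 0" "mc secA w u $3$0 = 0" "mc secA w u $4$0 = 0"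
      "mc secA w u $3$1 = 0" "mc secA w u $3$2 = 0" "mc secA w u $4$1 = 0" "mc secA w u $4$2 = 0"
  shows "u = 0"
proof -
  interpret A: group_map "x ` U" secA by (rule group_map_A)
  interpret B: group_map "x ` U" secB by (rule group_map_B)
  let ?S = "{g \<in> G42 \<times> G42. proj_D g \<in> U}"
  let ?g = "\<lambda>w. (secA w, secB w)"
  have inS: "?g y \<in> ?S" if "y \<in> x ` U" for y
    using section_G42[OF that] section_proj[OF that] inv_into_into[OF that] by (simp add: mem_Times_iff)
  have "smooth_on_subset ?S (\<lambda>g. x (proj_D g))" using chart by (simp add: chart_with_section_def)
  then have "\<exists>N X. open N \<and> ?g w \<in> N \<and> smooth_on N X \<and> (\<forall>g\<in>N \<inter> ?S. X g = x (proj_D g))"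
    using inS[OF w] unfolding smooth_on_subset_def by (rule bspec)
  then obtain N X where N: "open N" "?g w \<in> N" "smooth_on N X" and X: "\<And>g. g \<in> N \<inter> ?S \<Longrightarrow> X g = x (proj_D g)"
    by (elim exE conjE) simp
  obtain DX where DX: "(X has_derivative DX) (at (?g w))"
    using smooth_on_differentiable[OF N(3,2)] unfolding differentiable_def by blast
  have dg: "(?g has_derivative (\<lambda>u. (secA w ** mc secA w u, secB w ** mc secB w u))) (at w)"
    using has_derivative_Pair[OF A.differentiable_A[OF w] B.differentiable_A[OF w]]
    by (simp add: A.derivative_mc[OF w] B.derivative_mc[OF w])
  have "((\<lambda>y. X (?g y)) has_derivative (\<lambda>u. DX (secA w ** mc secA w u, secB w ** mc secB w u))) (at w)"
    using dg DX by (rule has_derivative_compose)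
  \<comment> \<open>Along the section \<open>X\<close> returns the coordinate of the point, as
    chart, projection and section compose to the identity.\<close>
  moreover have "((\<lambda>y. X (?g y)) has_derivative (\<lambda>u. u)) (at w)"
  proof (rule has_derivative_transform_within_open[OF has_derivative_ident])
    have "continuous_on (x ` U) ?g"
      using smooth_section by (intro continuous_on_Pair smooth_on_continuous)
    then show "open (x ` U \<inter> ?g -` N)" using open_chart N(1) by (rule continuous_open_preimage)
    show "w \<in> x ` U \<inter> ?g -` N" using w N(2) by simp
    show "y = X (?g y)" if "y \<in> x ` U \<inter> ?g -` N" for y
    proof -
      have y: "y \<in> x ` U" "?g y \<in> N" using that by auto
      then have "X (?g y) = x (proj_D (?g y))" using X inS by blast
      then show ?thesis using section_proj[OF y(1)] f_inv_into_f[OF y(1)] by simp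
    qed
  qed
  ultimately have "(\<lambda>u. DX (secA w ** mc secA w u, secB w ** mc secB w u)) = (\<lambda>u. u)"
    by (rule has_derivative_unique)
  from fun_cong[OF this, of u] have u: "DX (secA w ** mc secA w u, secB w ** mc secA w u) = u"
    using eq by simp
  note bl = bounded_bilinear.bounded_linear_right[OF bounded_bilinear_matrix_mult]
  \<comment> \<open>Equal Maurer-Cartan values mean that both components move by the same Lie
    algebra element, which the eight vanishing entries place in the isotropy algebra.\<close>
  have "DX (secA w ** mc secA w u, secB w ** mc secA w u) = 0"
  proof (rule isotropy_algebra_kernel[where L = "\<lambda>a. DX (secA w ** a, secB w ** a)", OF _ _ A.mc_so42[OF w] a])
    show "linear (\<lambda>a. DX (secA w ** a, secB w ** a))"
      by (rule bounded_linear.linear[OF bounded_linear_compose[OF has_derivative_bounded_linear[OF DX]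
            bounded_linear_Pair[OF bl bl]]])
    show "DX (secA w ** a, secB w ** a) = 0" if "isotropy_curve h a" for h a
      using that section_G42[OF w] inS[OF w] N(2) X
      by (intro derivative_along_isotropy[OF N(1) _ _ _ _ _ DX, of U x h]) auto
  qed
  then show ?thesis using u by simp
qed

abbreviation "\<kappa> j \<equiv> coframe_list (alpha_form U x s) (beta_form U x s) ! j"

lemma coframe_at:
  assumes "j < 23"
  shows "\<kappa> j w v = coframe_list (\<lambda>J K. mc secA w (v 0) $ J $ K) (\<lambda>J K. mc secB w (v 0) $ J $ K) ! j"
  using assms
  by (simp add: coframe_list_def less_Suc_eq numeral_eq_Suc alpha_form_def beta_form_def)
    (auto simp: mc_form_mc)

lemma isothermic_coframe_section: "isothermic_coframe (x ` U) \<kappa>"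
proof
  interpret A: group_map "x ` U" secA by (rule group_map_A)
  interpret B: group_map "x ` U" secB by (rule group_map_B)
  show "open (x ` U)" by (rule open_chart)
  show "DIM(real^23) = 23" by simp
  have sm: "smooth_form (x ` U) 1 (alpha_form U x s J K)" "smooth_form (x ` U) 1 (beta_form U x s J K)" for J K
    unfolding alpha_form_def beta_form_def by (rule A.smooth_form_mc B.smooth_form_mc)+
  show "smooth_form (x ` U) 1 (\<kappa> j)" if "j < 23" for j
  proof -
    have "\<forall>\<phi>\<in>set (coframe_list (alpha_form U x s) (beta_form U x s)). smooth_form (x ` U) 1 \<phi>"
      by (simp add: coframe_list_def smooth_form_1_diff[OF open_chart] sm del: One_nat_def)
    moreover have "length (coframe_list (alpha_form U x s) (beta_form U x s)) = 23"
      by (simp add: coframe_list_def)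
    ultimately show ?thesis using that by simp
  qed
  show "u = 0" if w: "w \<in> x ` U" and u: "\<forall>j<23. \<kappa> j w (\<lambda>_. u) = 0" for w u
  proof -
    let ?a = "mc secA w u" and ?b = "mc secB w u"
    have c: "coframe_list (\<lambda>J K. ?a $ J $ K) (\<lambda>J K. ?b $ J $ K) ! j = 0" if "j < 23" for j
      using u that by (simp add: coframe_at)
    have z: "?a$1$0 = 0" "?a$2$0 = 0" "?a$3$1 = 0" "?a$3$2 = 0" "?a$4$1 = 0" "?a$4$2 = 0"
      "?b$0$1 = ?a$0$1" "?b$0$2 = ?a$0$2" "?b$1$0 = ?a$1$0" "?b$2$0 = ?a$2$0"
      "?a$3$0 = 0" "?a$4$0 = 0" "?b$3$0 = 0" "?b$4$0 = 0" "?b$0$0 = ?a$0$0" "?b$2$1 = ?a$2$1" "?b$4$3 = ?a$4$3"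
      "?b$3$1 = ?a$3$1" "?b$3$2 = ?a$3$2" "?b$4$1 = ?a$4$1" "?b$4$2 = ?a$4$2" "?b$0$3 = ?a$0$3" "?b$0$4 = ?a$0$4"
      using c[of 0] c[of 1] c[of 2] c[of 3] c[of 4] c[of 5] c[of 6] c[of 7] c[of 8] c[of 9] c[of 10]
        c[of 11] c[of 12] c[of 13] c[of 14] c[of 15] c[of 16] c[of 17] c[of 18] c[of 19] c[of 20] c[of 21] c[of 22]
      unfolding coframe_list_def by simp_all
    \<comment> \<open>The list covers all 15 independent entries of the Lie algebra: each is either
      zero on both sides or equal on both sides, and skewness supplies the other entries.\<close>
    have "?a = ?b"
      unfolding vec_eq_iff forall_6
      by (simp add: so42_entries[OF A.mc_so42[OF w]] so42_entries[OF B.mc_so42[OF w]] z)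
    then show ?thesis by (rule section_transversal[OF w]) (rule z)+
  qed
  show "(\<forall>j\<in>{8..<23}. ext_deriv 1 (\<kappa> j) w e = 0) \<longleftrightarrow>
      isothermic_relations (\<lambda>j. \<kappa> j w (\<lambda>_. e 0)) (\<lambda>j. \<kappa> j w (\<lambda>_. e 1))"
    if w: "w \<in> x ` U" and e: "\<forall>j\<in>{8..<23}. \<forall>i<2. \<kappa> j w (\<lambda>_. e i) = 0" for w e
  proof -
    let ?a = "\<lambda>i. mc secA w (e i)" and ?b = "\<lambda>i. mc secB w (e i)"
    let ?l = "\<lambda>i. coframe_list (\<lambda>J K. ?a i $ J $ K) (\<lambda>J K. ?b i $ J $ K)"
    have gens: "\<forall>j\<in>{8..<23}. ?l i ! j = 0" if "i < 2" for i
      using e that by (simp add: coframe_at)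
    have "ext_deriv 1 (\<kappa> j) w e
        = coframe_list (\<lambda>J K. ext_deriv 1 (alpha_form U x s J K) w e) (\<lambda>J K. ext_deriv 1 (beta_form U x s J K) w e) ! j"
      if "j \<in> {8..<23}" for j
      using that unfolding atLeastLessThan_8_23 coframe_list_def
      by (auto simp: ext_deriv_1_diff[OF open_chart sm(1) sm(2) w] simp del: One_nat_def)
    then have "ext_deriv 1 (\<kappa> j) w e = coframe_list (\<lambda>J K. - (?a 0 ** ?a 1 - ?a 1 ** ?a 0) $ J $ K)
         (\<lambda>J K. - (?b 0 ** ?b 1 - ?b 1 ** ?b 0) $ J $ K) ! j" if "j \<in> {8..<23}" for j
      using that unfolding alpha_form_def beta_form_def A.ext_deriv_mc[OF w] B.ext_deriv_mc[OF w] by blast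
    then have "(\<forall>j\<in>{8..<23}. ext_deriv 1 (\<kappa> j) w e = 0) \<longleftrightarrow>
      (\<forall>j\<in>{8..<23}. coframe_list (\<lambda>J K. - (?a 0 ** ?a 1 - ?a 1 ** ?a 0) $ J $ K)
         (\<lambda>J K. - (?b 0 ** ?b 1 - ?b 1 ** ?b 0) $ J $ K) ! j = 0)"
      by (intro ball_cong refl) (simp only:)
    also have "\<dots> \<longleftrightarrow> isothermic_relations ((!) (?l 0)) ((!) (?l 1))"
      by (rule isothermic_torsion) (use A.mc_so42[OF w] B.mc_so42[OF w] gens in auto)
    also have "\<dots> \<longleftrightarrow> isothermic_relations (\<lambda>j. \<kappa> j w (\<lambda>_. e 0)) (\<lambda>j. \<kappa> j w (\<lambda>_. e 1))"
      unfolding isothermic_relations_def by (simp add: coframe_at)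
    finally show ?thesis .
  qed
qed

end

theorem mainTheorem3:
  fixes p :: config
    and U :: "config set"
    and x :: "config \<Rightarrow> real^23"
    and s :: "config \<Rightarrow> (real^6^6) \<times> (real^6^6)"
  assumes "p \<in> D_space" and "chart_with_section U x s" and "p \<in> U"
  shows "in_involution_at (x ` U) (I3_ideal U x s) 2 (independence_form U x s) (x p) \<and>
         general_solution_depends_on_at (x ` U) (I3_ideal U x s) 2 (independence_form U x s) 6 1 (x p)"
proof -
  interpret isothermic_coframe "x ` U" "\<lambda>j. coframe_list (alpha_form U x s) (beta_form U x s) ! j"
    by (rule isothermic_coframe_section[OF assms(2)])
  have "x p \<in> x ` U" using assms(3) by simp
  from in_involution[OF this] general_solution[OF this] show ?thesis
    unfolding I3_ideal_def I3_gens_coframe independence_form_def by (simp add: coframe_list_def)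
qed

end
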